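(* Let $n$ be a positive odd integer. Then \[ \sum_{k=0}^{n-1}(-1)^k [4k+1]\frac{(q;q^2)_k^5}{(q^2;q^2)_k^5}\, q^{k^2+k} \equiv [n]\,q^{(1-n)/2} \sum_{k=0}^{(n-1)/2} \frac{(q;q^2)_k^3}{(q^2;q^2)_k^3}\, q^{2k} \pmod{[n]\Phi_n(q)^2}, \] and \[ \sum_{k=0}^{(n-1)/2}(-1)^k [4k+1]\frac{(q;q^2)_k^5}{(q^2;q^2)_k^5}\, q^{k^2+k} \equiv [n]\,q^{(1-n)/2} \sum_{k=0}^{(n-1)/2} \frac{(q;q^2)_k^3}{(q^2;q^2)_k^3}\, q^{2k} \pmod{[n]\Phi_n(q)^2}. \]
   Context: Here $q$ is an indeterminate. For $x$ and a base $p$ (a power of $q$), $(x;p)_k=\prod_{j=0}^{k-1}(1-xp^j)$ for integers $k\ge 0$. The $q$-integer is $[n]=1+q+\cdots+q^{n-1}$, and $\Phi_n(q)$ is the $n$-th cyclotomic polynomial. For rational functions $A(q),B(q)$ and a polynomial $P(q)$, $A(q)\equiv B(q)\pmod{P(q)}$ means that the numerator of the reduced form of $A(q)-B(q)$ is divisible by $P(q)$ in $\mathbb{Z}[q]$. *)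

theory Defs
  imports "HOL-Computational_Algebra.Computational_Algebra" Complex_Main
begin

text \<open>The field of rational functions in \<open>q\<close> is the fraction field of \<open>\<int>[q]\<close>.\<close>

type_synonym ratfun = "int poly fract"

definition qvar :: ratfun where
  "qvar = to_fract [:0, 1:]"

definition qpoch :: "'a::comm_ring_1 \<Rightarrow> 'a \<Rightarrow> nat \<Rightarrow> 'a" where
  "qpoch x p k = (\<Prod>j<k. 1 - x * p ^ j)"

definition qint :: "'a::comm_semiring_1 \<Rightarrow> nat \<Rightarrow> 'a" where
  "qint x n = (\<Sum>i<n. x ^ i)"

definition primitive_roots_of_unity :: "nat \<Rightarrow> complex set" where
  "primitive_roots_of_unity n = {z. z ^ n = 1 \<and> (\<forall>m. 0 < m \<and> m < n \<longrightarrow> z ^ m \<noteq> 1)}"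

text \<open>Existence and uniqueness of the described polynomial is
  \<open>of_int_cyclotomic\<close> below.\<close>

definition cyclotomic :: "nat \<Rightarrow> int poly" where
  "cyclotomic n =
     (THE P. map_poly complex_of_int P = (\<Prod>z\<in>primitive_roots_of_unity n. [:- z, 1:]))"

text \<open>\<open>quot_of_fract\<close> gives the reduced form over \<open>\<int>[q]\<close>: coprime numerator and
  denominator, the denominator having positive leading coefficient.\<close>

definition ratfun_cong :: "ratfun \<Rightarrow> ratfun \<Rightarrow> int poly \<Rightarrow> bool" where
  "ratfun_cong A B P \<longleftrightarrow> P dvd fst (quot_of_fract (A - B))"

lemma of_int_poly_eq_iff:
  "map_poly complex_of_int P = map_poly complex_of_int Q \<longleftrightarrow> P = Q"
  by (auto simp: poly_eq_iff coeff_map_poly)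

lemma of_int_poly_mult:
  "map_poly complex_of_int (P * Q) = map_poly complex_of_int P * map_poly complex_of_int Q"
  by (auto simp: poly_eq_iff coeff_map_poly coeff_mult)

lemma of_int_poly_add:
  "map_poly complex_of_int (P + Q) = map_poly complex_of_int P + map_poly complex_of_int Q"
  by (auto simp: poly_eq_iff coeff_map_poly)

lemma of_int_poly_prod:
  "map_poly complex_of_int (\<Prod>i\<in>A. f i) = (\<Prod>i\<in>A. map_poly complex_of_int (f i))"
  by (induction A rule: infinite_finite_induct) (simp_all add: of_int_poly_mult)

lemma finite_primitive_roots_of_unity:
  assumes "n > 0" shows "finite (primitive_roots_of_unity n)"
  by (rule finite_subset[OF _ finite_roots_unity[of n]])
     (use assms in \<open>auto simp: primitive_roots_of_unity_def\<close>)

lemma primitive_roots_of_unity_Union: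
  assumes n: "n > 0"
  shows "(\<Union>d\<in>{d. d dvd n}. primitive_roots_of_unity d) = {z. z ^ n = 1}"
proof (intro equalityI subsetI)
  fix z assume "z \<in> (\<Union>d\<in>{d. d dvd n}. primitive_roots_of_unity d)"
  then show "z \<in> {z. z ^ n = 1}"
    by (auto simp: primitive_roots_of_unity_def power_mult elim!: dvdE)
next
  fix z :: complex assume "z \<in> {z. z ^ n = 1}"
  then have zn: "z ^ n = 1" by simp
  define d where "d = (LEAST m. 0 < m \<and> z ^ m = 1)"
  have d: "0 < d \<and> z ^ d = 1" unfolding d_def by (rule LeastI[of _ n]) (use n zn in auto)
  have least: "z ^ m \<noteq> 1" if "0 < m" "m < d" for m
    using not_less_Least[of m "\<lambda>m. 0 < m \<and> z ^ m = 1"] that by (auto simp: d_def)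
  have "z ^ n = z ^ (d * (n div d) + n mod d)" by simp
  also have "\<dots> = z ^ (n mod d)" using d by (simp only: power_add power_mult) simp
  finally have "n mod d = 0" using zn least[of "n mod d"] d by fastforce
  then have "d dvd n" by auto
  moreover have "z \<in> primitive_roots_of_unity d"
    using d least by (auto simp: primitive_roots_of_unity_def)
  ultimately show "z \<in> (\<Union>d\<in>{d. d dvd n}. primitive_roots_of_unity d)" by blast
qed

lemma primitive_roots_of_unity_disjoint:
  assumes "0 < d" "0 < e" "d \<noteq> e"
  shows "primitive_roots_of_unity d \<inter> primitive_roots_of_unity e = {}"
  using assms by (auto simp: primitive_roots_of_unity_def) (metis linorder_neqE_nat)

lemma prod_roots_of_unity:
  assumes n: "n > 0"
  shows "(\<Prod>z | z ^ n = 1. [:- z, 1:]) = monom (1::complex) n - 1"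
proof -
  let ?R = "{z::complex. z ^ n = 1}" and ?f = "monom (1::complex) n - 1"
  let ?p = "\<Prod>z\<in>?R. [:- z, 1:]"
  have fin: "finite ?R" using n by (intro finite_roots_unity) auto
  have deg: "degree ?p = n"
    using card_roots_unity_eq[OF n] by (subst degree_prod_sum_eq) auto
  have lc: "lead_coeff ?p = 1" by (simp add: lead_coeff_prod)
  have "?p - ?f = 0"
  proof (rule ccontr)
    assume nz: "?p - ?f \<noteq> 0"
    have "coeff (?p - ?f) n = 0" using deg lc n by (simp add: coeff_diff)
    moreover have le: "degree (?p - ?f) \<le> n"
      by (intro degree_diff_le) (use deg degree_monom_le[of "1::complex" n] in auto)
    ultimately have lt: "degree (?p - ?f) < n"
      using nz by (metis le_neq_implies_less leading_coeff_0_iff)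
    have "?R \<subseteq> {z. poly (?p - ?f) z = 0}"
      using fin by (auto simp: poly_prod poly_monom)
    then have "card ?R \<le> card {z. poly (?p - ?f) z = 0}"
      using poly_roots_finite[OF nz] by (rule card_mono[rotated])
    also have "\<dots> \<le> degree (?p - ?f)" using nz by (rule card_poly_roots_bound)
    finally have "card ?R \<le> degree (?p - ?f)" .
    then show False using lt card_roots_unity_eq[OF n] by simp
  qed
  then show ?thesis by simp
qed

lemma prod_primitive_roots_of_unity:
  assumes n: "n > 0"
  shows "(\<Prod>d | d dvd n. \<Prod>z\<in>primitive_roots_of_unity d. [:- z, 1:]) = monom 1 n - 1"
proof -
  have pos: "0 < d" if "d dvd n" for d using that n by (auto intro: Nat.gr0I)
  have "(\<Prod>z\<in>(\<Union>d\<in>{d. d dvd n}. primitive_roots_of_unity d). [:- z, 1:]) =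
        (\<Prod>d | d dvd n. \<Prod>z\<in>primitive_roots_of_unity d. [:- z, 1:])"
    using n pos
    by (intro prod.UNION_disjoint)
       (auto simp: finite_primitive_roots_of_unity primitive_roots_of_unity_disjoint)
  then show ?thesis using primitive_roots_of_unity_Union[OF n] prod_roots_of_unity[OF n] by simp
qed

lemma ex_of_int_cyclotomic:
  "n > 0 \<Longrightarrow>
    \<exists>P. map_poly complex_of_int P = (\<Prod>z\<in>primitive_roots_of_unity n. [:- z, 1:])"
proof (induction n rule: less_induct)
  case (less n)
  let ?C = "\<lambda>n. \<Prod>z\<in>primitive_roots_of_unity n. [:- z, 1:]"
  let ?D = "{d. d dvd n \<and> d < n}"
  have pos: "0 < d" if "d dvd n" for d using that less.prems by (auto intro: Nat.gr0I)
  have "\<forall>d\<in>?D. \<exists>P. map_poly complex_of_int P = ?C d" using less.IH pos by auto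
  then obtain Q where Q: "\<And>d. d \<in> ?D \<Longrightarrow> map_poly complex_of_int (Q d) = ?C d"
    by metis
  define M where "M = (\<Prod>d\<in>?D. Q d)"
  have M: "map_poly complex_of_int M = (\<Prod>d\<in>?D. ?C d)"
    unfolding M_def of_int_poly_prod by (intro prod.cong) (auto simp: Q)
  have degM: "degree (map_poly complex_of_int P) = degree P" for P
    by (rule degree_map_poly) auto
  have "complex_of_int (lead_coeff M) = lead_coeff (map_poly complex_of_int M)"
    by (simp add: degM coeff_map_poly)
  also have "\<dots> = 1" unfolding M by (simp add: lead_coeff_prod)
  finally have lcM: "lead_coeff M = 1" by simp
  then have M0: "M \<noteq> 0" by auto
  obtain S R where SR: "pseudo_divmod (monom 1 n - 1) M = (S, R)" by force
  have eq: "monom 1 n - 1 = M * S + R" and R: "R = 0 \<or> degree R < degree M"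
    using pseudo_divmod[OF M0 SR] lcM by auto
  have "{d. d dvd n} = insert n ?D" using less.prems by (auto dest: dvd_imp_le)
  then have "(\<Prod>d | d dvd n. ?C d) = ?C n * (\<Prod>d\<in>?D. ?C d)" by simp
  then have "monom 1 n - 1 = ?C n * map_poly complex_of_int M"
    using prod_primitive_roots_of_unity[OF less.prems] M by simp
  moreover have "map_poly complex_of_int (monom 1 n - 1) = monom 1 n - 1"
    by (auto simp: poly_eq_iff coeff_map_poly)
  ultimately have "?C n * map_poly complex_of_int M =
      map_poly complex_of_int M * map_poly complex_of_int S + map_poly complex_of_int R"
    using eq by (simp add: of_int_poly_mult of_int_poly_add)
  then have *: "map_poly complex_of_int M * (?C n - map_poly complex_of_int S) =
      map_poly complex_of_int R"
    by (simp add: algebra_simps)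
  have "?C n - map_poly complex_of_int S = 0"
  proof (rule ccontr)
    assume nz: "?C n - map_poly complex_of_int S \<noteq> 0"
    have M0': "map_poly complex_of_int M \<noteq> 0" using M0 of_int_poly_eq_iff[of M 0] by simp
    have "R \<noteq> 0" using * nz M0' by auto
    moreover have "degree R = degree M + degree (?C n - map_poly complex_of_int S)"
      using degree_mult_eq[OF M0' nz] by (simp only: * degM)
    ultimately show False using R by simp
  qed
  then show ?case by (intro exI[of _ S]) simp
qed

lemma of_int_cyclotomic:
  assumes "n > 0"
  shows "map_poly complex_of_int (cyclotomic n) =
    (\<Prod>z\<in>primitive_roots_of_unity n. [:- z, 1:])"
  unfolding cyclotomic_def
  by (rule theI') (use ex_of_int_cyclotomic[OF assms] of_int_poly_eq_iff in metis)

end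

(*
  The identity behind the congruence is a limiting case of Watson's 8-phi-7 transformation.  With
  n = 2 m + 1 and x = q^n, replace one pair of factors (q;q^2)_k^2 / (q^2;q^2)_k^2 on the left by
  (xq, q/x; q^2)_k / (xq^2, q^2/x; q^2)_k and one pair (q;q^2)_k^2 on the right by
  (xq, q/x; q^2)_k; the two sides then agree exactly (watson_special).  This follows from
  the q-Saalschuetz sum and a terminating Bailey-pair sum, each proved by WZ telescoping.

  Undoing the replacement costs a multiple of s = (1 - x)^2 / x, of order 2 at a primitive n-th
  root of unity z, because both sides are invariant under x -> 1/x.  The coefficient of s on the
  left vanishes at z as well, since the k-th and the (m-k)-th summand are opposite there; this
  gives order 3.  At roots of unity of smaller order d | n the sums split into blocks of length d
  which vanish by the same antisymmetry.
*)
theory Submission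
  imports Defs "HOL-Computational_Algebra.Field_as_Ring"
begin

subsection \<open>Two terminating summations\<close>

text \<open>The choice x = q^n makes the deformed sums terminate at k = m: the factor 1 - q^(2j+1)/x
  is zero at j = m, whereas 1 - q^(2j+2)/x is never zero, its exponent being odd. The two sides of
  the congruence are not treated alike. On the right the deformation needs to be undone only to
  second order, because the prefactor 1 - q^n supplies the third. On the left nothing is supplied,
  so the coefficient of s has to be known explicitly; it is a sum over differences of y/(1-y)^2 with
  y = q^i. At roots of order d < n the obstacle is that (q^2;q^2)_k vanishes as soon as k >= d, so a
  summand is a quotient of two vanishing products. It is regular all the same, because a root of
  unity of odd order has no power equal to -1; its value is known only up to a factor common to a
  whole block, which is enough. Both sides are multiplied by 1 - q, which turns q-integers into 1 -
  q^k. This can be undone at every root z of the modulus when n > 1, since z is never 1.\<close>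

lemma qpoch_0 [simp]: "qpoch x p 0 = 1"
  by (simp add: qpoch_def)

lemma qpoch_Suc: "qpoch x p (Suc k) = qpoch x p k * (1 - x * p ^ k)"
  by (simp add: qpoch_def)

lemma qpoch_add: "qpoch x p (m + k) = qpoch x p m * qpoch (x * p ^ m) p k"
  by (induction k) (simp_all add: qpoch_Suc power_add mult_ac)

lemma qpoch_nonzero:
  fixes x :: "'a::field"
  assumes "\<And>j. j < k \<Longrightarrow> x * p ^ j \<noteq> 1"
  shows "qpoch x p k \<noteq> 0"
  using assms by (force simp: qpoch_def)


text \<open>The right-hand side is the WZ companion of the q-Saalschuetz summand.\<close>

lemma q_saalschuetz_partial:
  fixes A D X p :: "'a::field"
  assumes p: "\<And>i. i > 0 \<Longrightarrow> p ^ i \<noteq> 1" and C: "\<And>i. qpoch (A * D) p i \<noteq> 0"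
  defines "t \<equiv> \<lambda>M i. qpoch A p i * qpoch (X * D) p i * (\<Prod>l<M-i. X - p ^ l) /
      (qpoch p p i * qpoch p p (M - i) * qpoch (A * D) p i)"
  assumes "K \<le> M"
  shows "(\<Sum>i\<le>K. (1 - p ^ Suc M) * (1 - A * D * p ^ M) * t (Suc M) i - (X - A * p ^ M) * (1 - D * p ^ M) * t M i)
    = - (p ^ (M - K) * qpoch A p (Suc K) * qpoch (X * D) p (Suc K) * (\<Prod>l<M-K. X - p ^ l) /
      (qpoch p p K * qpoch p p (M - K) * qpoch (A * D) p K))"
  using \<open>K \<le> M\<close>
proof (induction K)
  have e: "qpoch p p i \<noteq> 0" for i
    using p[of "Suc _"] by (intro qpoch_nonzero) auto
  case 0
  have *: "1 - p * p ^ M \<noteq> 0" using p[of "Suc M"] by simp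
  have "(1 - p ^ Suc M) * (1 - A * D * p ^ M) * t (Suc M) 0 - (X - A * p ^ M) * (1 - D * p ^ M) * t M 0
    = ((1 - A * D * p ^ M) * (X - p ^ M) - (X - A * p ^ M) * (1 - D * p ^ M)) * (\<Prod>l<M. X - p ^ l) / qpoch p p M"
    using e[of M] * by (simp add: t_def qpoch_Suc field_simps)
  also have "(1 - A * D * p ^ M) * (X - p ^ M) - (X - A * p ^ M) * (1 - D * p ^ M) = - (p ^ M * (1 - A) * (1 - X * D))"
    by algebra
  finally show ?case by (simp add: qpoch_Suc)
next
  have e: "qpoch p p i \<noteq> 0" for i
    using p[of "Suc _"] by (intro qpoch_nonzero) auto
  case (Suc K)
  \<comment> \<open>Replacing M - K - 1 by \<open>r\<close> removes truncated subtraction; every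
    power of \<open>p\<close> becomes a monomial in \<open>p\<close>, \<open>u\<close> and
    \<open>v\<close>.\<close>
  then obtain r where M: "M = Suc (K + r)" using less_eqE by (metis Suc_le_lessD less_iff_Suc_add)
  define u where "u = p ^ K"
  define v where "v = p ^ r"
  define Q where "Q = qpoch A p (Suc K) * qpoch (X * D) p (Suc K) * (\<Prod>l<r. X - p ^ l)"
  define R where "R = qpoch p p (Suc K) * qpoch p p r * qpoch (A * D) p (Suc K)"
  have nz: "1 - p * v \<noteq> 0" "1 - p * u \<noteq> 0" "1 - A * D * u \<noteq> 0" "R \<noteq> 0"
    using p[of "Suc r"] p[of "Suc K"] C[of "Suc K"] e C unfolding u_def v_def R_def 
    by (auto simp: qpoch_Suc)
  have pr: "p ^ K = u" "p ^ r = v" "p ^ M = p * u * v" "p ^ Suc M = p * p * u * v"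
    by (simp_all add: u_def v_def M power_add)
  have d: "Suc M - Suc K = Suc r" "M - Suc K = r" "M - K = Suc r" by (auto simp: M)
  have t1: "t (Suc M) (Suc K) = Q * (X - v) / (R * (1 - p * v))"
    unfolding t_def d Q_def R_def by (simp add: qpoch_Suc pr divide_simps mult_ac)
  have t2: "t M (Suc K) = Q / R"
    unfolding t_def d Q_def R_def by (simp add: mult_ac)
  have t3: "p ^ (M - K) * qpoch A p (Suc K) * qpoch (X * D) p (Suc K) * (\<Prod>l<M-K. X - p ^ l) /
      (qpoch p p K * qpoch p p (M - K) * qpoch (A * D) p K)
      = p * v * Q * (X - v) * (1 - p * u) * (1 - A * D * u) / (R * (1 - p * v))"
    unfolding d Q_def R_def using nz e[of K] e[of r] C[of K] by (simp add: qpoch_Suc pr divide_simps mult_ac)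
  have t4: "p ^ (M - Suc K) * qpoch A p (Suc (Suc K)) * qpoch (X * D) p (Suc (Suc K)) * (\<Prod>l<M-Suc K. X - p ^ l) /
      (qpoch p p (Suc K) * qpoch p p (M - Suc K) * qpoch (A * D) p (Suc K))
      = v * (1 - A * p * u) * (1 - X * D * p * u) * Q / R"
    unfolding d Q_def R_def qpoch_Suc[of _ _ "Suc K"] by (simp add: pr mult_ac)
  \<comment> \<open>\<open>S\<close> is the part common to all terms, denominators included. What
    remains of the induction step is an identity between polynomials.\<close>
  define S where "S = Q / (R * (1 - p * v))"
  have Q: "Q = S * R * (1 - p * v)" using nz by (simp add: S_def)
  have "- (p * v * S * (X - v) * (1 - p * u) * (1 - A * D * u)) +
      ((1 - p * p * u * v) * (1 - A * D * (p * u * v)) * (S * (X - v)) -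
       (X - A * (p * u * v)) * (1 - D * (p * u * v)) * (S * (1 - p * v)))
    = - (v * (1 - A * p * u) * (1 - X * D * p * u) * S * (1 - p * v))"
    by algebra
  then show ?case
    unfolding sum.atMost_Suc Suc.IH[OF Suc_leD[OF Suc.prems]] t3 t4 t1 t2
    unfolding pr Q using nz by (simp add: mult_ac)
qed

text \<open>This is the sum of 3phi2(A, X D, p^(-M); A D, X p^(1-M); p, p), multiplied by the
  product of the X - p^l for l < M and divided by (p;p)_M. The summand becomes polynomial in X, and
  naming the lower parameter \<open>A * D\<close> avoids a quotient of parameters on the
  right.\<close>

lemma q_saalschuetz:
  fixes A D X p :: "'a::field"
  assumes p: "\<And>i. i > 0 \<Longrightarrow> p ^ i \<noteq> 1" and C: "\<And>i. qpoch (A * D) p i \<noteq> 0"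
  shows "(\<Sum>i\<le>M. qpoch A p i * qpoch (X * D) p i * (\<Prod>l<M-i. X - p ^ l) /
      (qpoch p p i * qpoch p p (M - i) * qpoch (A * D) p i))
    = qpoch D p M * (\<Prod>l<M. X - A * p ^ l) / (qpoch p p M * qpoch (A * D) p M)"
proof (induction M)
  case 0
  show ?case by simp
next
  case (Suc M)
  define t where "t M i = qpoch A p i * qpoch (X * D) p i * (\<Prod>l<M-i. X - p ^ l) /
      (qpoch p p i * qpoch p p (M - i) * qpoch (A * D) p i)" for M i
  have e: "qpoch p p i \<noteq> 0" for i
    using p[of "Suc _"] by (intro qpoch_nonzero) auto
  let ?c = "(1 - p ^ Suc M) * (1 - A * D * p ^ M)"
  let ?d = "(X - A * p ^ M) * (1 - D * p ^ M)"
  have nz: "?c \<noteq> 0" using p[of "Suc M"] C[of "Suc M"] by (auto simp: qpoch_Suc)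
  \<comment> \<open>At \<open>K = M\<close> the companion equals the term \<open>i = Suc M\<close>
    that the longer sum has in addition. The sums therefore satisfy a first-order recurrence in M
    with coefficients \<open>?c\<close> and \<open>?d\<close>.\<close>
  have "(\<Sum>i\<le>M. ?c * t (Suc M) i - ?d * t M i) = - (?c * t (Suc M) (Suc M))"
    using q_saalschuetz_partial[where K = M and M = M and X = X, OF p C order_refl]
      nz e[of M] e[of "Suc M"] C[of M] C[of "Suc M"]
    by (simp add: t_def qpoch_Suc divide_simps mult_ac)
  then have "?c * (\<Sum>i\<le>M. t (Suc M) i) - ?d * (\<Sum>i\<le>M. t M i) = - (?c * t (Suc M) (Suc M))"
    by (simp only: sum_subtractf sum_distrib_left)
  then have "?c * (\<Sum>i\<le>Suc M. t (Suc M) i) = ?d * (\<Sum>i\<le>M. t M i)"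
    unfolding sum.atMost_Suc distrib_left by (simp only: diff_eq_eq) simp
  also have "(\<Sum>i\<le>M. t M i) = qpoch D p M * (\<Prod>l<M. X - A * p ^ l) / (qpoch p p M * qpoch (A * D) p M)"
    using Suc.IH by (simp add: t_def)
  finally have "(\<Sum>i\<le>Suc M. t (Suc M) i) =
      ?d * (qpoch D p M * (\<Prod>l<M. X - A * p ^ l) / (qpoch p p M * qpoch (A * D) p M)) / ?c"
    using nz by (metis nonzero_mult_div_cancel_left)
  also have "\<dots> = qpoch D p (Suc M) * (\<Prod>l<Suc M. X - A * p ^ l) / (qpoch p p (Suc M) * qpoch (A * D) p (Suc M))"
    by (simp add: qpoch_Suc mult_ac)
  finally show ?case by (simp add: t_def)
qed

section \<open>Sums in base q^2, for q not a root of unity\<close>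

locale generic_base =
  fixes q :: "'a::field"
  assumes q_nonzero [simp]: "q \<noteq> 0" and q_power: "i > 0 \<Longrightarrow> q ^ i \<noteq> 1"
begin

definition odds :: "nat \<Rightarrow> 'a" where "odds k = qpoch q (q ^ 2) k"
definition evens :: "nat \<Rightarrow> 'a" where "evens k = qpoch (q ^ 2) (q ^ 2) k"

lemma odds_0 [simp]: "odds 0 = 1" and evens_0 [simp]: "evens 0 = 1"
  by (simp_all add: odds_def evens_def)

lemma odds_Suc: "odds (Suc k) = odds k * (1 - q ^ (2 * k + 1))"
  by (simp add: odds_def qpoch_Suc power_mult)

lemma evens_Suc: "evens (Suc k) = evens k * (1 - q ^ (2 * k + 2))"
  by (simp add: evens_def qpoch_Suc add.commute flip: power_mult power_add del: add_2_eq_Suc add_2_eq_Suc')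

lemma one_minus_q_power: "i > 0 \<Longrightarrow> 1 - q ^ i \<noteq> 0"
  using q_power by fastforce

lemma odds_nonzero [simp]: "odds k \<noteq> 0"
  by (induction k) (use q_power in \<open>simp_all add: odds_Suc del: power_Suc\<close>)

lemma evens_nonzero [simp]: "evens k \<noteq> 0"
  by (induction k) (use q_power in \<open>simp_all add: evens_Suc del: power_Suc add_2_eq_Suc'\<close>)

text \<open>The WZ companion for the recurrence (1 - q^(2j+2))^2 S(j+1) = S(j), where S(j) is the
  sum evaluated in \<open>bailey_sum\<close>.\<close>

lemma bailey_partial:
  assumes "K \<le> j"
  defines "t \<equiv> \<lambda>j k. (1 - q ^ (4 * k + 1)) * (odds k / evens k) ^ 2 * q ^ (2 * k ^ 2) / (evens (j - k) * odds (j + k + 1))"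
  shows "(\<Sum>k\<le>K. (1 - q ^ (2 * j + 2)) ^ 2 * t (Suc j) k - t j k) =
    - (q ^ (2 * (j - K)) * (1 - q ^ (2 * K + 1)) ^ 2 * (odds K / evens K) ^ 2 * q ^ (2 * (K + 1) ^ 2)
       / (evens (j - K) * odds (j + K + 2)))"
  using \<open>K \<le> j\<close>
proof (induction K)
  case 0
  define P where "P = q ^ (2 * j)"
  have o: "odds (Suc (Suc j)) = odds (Suc j) * (1 - P * q ^ 3)"
    by (simp add: odds_Suc[of "Suc j"] P_def power_add eval_nat_numeral mult_ac)
  have e: "evens (Suc j) = evens j * (1 - P * q ^ 2)"
    by (simp add: evens_Suc P_def power2_eq_square mult_ac)
  have P: "q ^ (2 * j + 2) = P * q ^ 2" by (simp add: P_def power_add power2_eq_square)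
  have nz: "1 - P * q ^ 2 \<noteq> 0" "1 - P * q ^ 3 \<noteq> 0"
    using q_power[of "2*j+2"] q_power[of "2*j+3"] by (simp_all add: P_def power_add power2_eq_square mult_ac)
  define S where "S = 1 / (evens j * odds (Suc j) * (1 - P * q ^ 3))"
  have "(1 - q ^ (2 * j + 2)) ^ 2 * t (Suc j) 0 = (1 - P * q^2) * (1 - q) * S"
    unfolding P t_def S_def using nz by (simp add: o e divide_simps power2_eq_square)
  moreover have "t j 0 = (1 - q) * (1 - P * q ^ 3) * S"
    using nz by (simp add: t_def S_def)
  moreover have "q ^ (2 * (j - 0)) * (1 - q ^ (2 * 0 + 1)) ^ 2 * (odds 0 / evens 0) ^ 2 * q ^ (2 * (0 + 1) ^ 2)
       / (evens (j - 0) * odds (j + 0 + 2)) = P * (1 - q) ^ 2 * q ^ 2 * S"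
    using nz by (simp add: S_def o P_def)
  moreover have "(1 - P * q^2) * (1 - q) * S - (1 - q) * (1 - P * q ^ 3) * S = - (P * (1 - q) ^ 2 * q ^ 2 * S)"
    by algebra
  ultimately show ?case by simp
next
  case (Suc K)
  then obtain r where j: "j = Suc (K + r)" by (metis Suc_le_lessD less_iff_Suc_add)
  define k where "k = Suc K"
  have jk: "j = k + r" and K: "K + 1 = k" by (auto simp: j k_def)
  define u where "u = q ^ (2 * k)"
  define v where "v = q ^ (2 * r)"
  define B where "B = (odds k / evens k) ^ 2 * q ^ (2 * k ^ 2)"
  have nz: "1 - q^2 * v \<noteq> 0" "1 - u * u * v * q \<noteq> 0" "1 - u * u * v * q ^ 3 \<noteq> 0" "1 - u \<noteq> 0"
  proof -
    have "q ^ 2 * v = q ^ (2 * r + 2)" "u * u * v * q = q ^ (2 * k + 2 * k + 2 * r + 1)"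
      "u * u * v * q ^ 3 = q ^ (2 * k + 2 * k + 2 * r + 3)"
      unfolding u_def v_def by (simp_all only: power_add power_one_right mult_ac)
    then show "1 - q ^ 2 * v \<noteq> 0" "1 - u * u * v * q \<noteq> 0" "1 - u * u * v * q ^ 3 \<noteq> 0" "1 - u \<noteq> 0"
      using q_power[of "2*r+2"] q_power[of "2*k+2*k+2*r+1"] q_power[of "2*k+2*k+2*r+3"] q_power[of "2*k"]
      by (simp_all add: u_def k_def del: power_Suc add_2_eq_Suc')
  qed
  have o: "odds (j + k + 2) = odds (j + k + 1) * (1 - u * u * v * q ^ 3)"
    using odds_Suc[of "j+k+1"] by (simp add: u_def v_def jk power_add eval_nat_numeral mult_ac)
  have e: "evens (Suc r) = evens r * (1 - q ^ 2 * v)"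
    by (simp add: evens_Suc v_def power2_eq_square mult_ac)
  define S where "S = B / (evens r * (1 - q^2 * v) * odds (j + k + 2))"
  have p4: "q ^ (4 * k + 1) = u * u * q"
    by (simp add: u_def flip: power_add power_Suc2)
  have d: "Suc j - k = Suc r" "j - k = r" "j - K = Suc r" by (auto simp: jk k_def)
  have pj: "q ^ (2 * j + 2) = u * v * q ^ 2" by (simp add: u_def v_def jk power_add power2_eq_square)
  have "(1 - q ^ (2 * j + 2)) ^ 2 * t (Suc j) k = (1 - u * v * q ^ 2) ^ 2 * (1 - u * u * q) * S"
    unfolding t_def d S_def pj p4 e B_def by (simp add: mult_ac)
  moreover have "t j k = (1 - u * u * q) * (1 - q ^ 2 * v) * (1 - u * u * v * q ^ 3) * S"
    unfolding t_def d S_def p4 B_def o using nz by simp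
  moreover have "q ^ (2 * (j - K)) * (1 - q ^ (2 * K + 1)) ^ 2 * (odds K / evens K) ^ 2 * q ^ (2 * (K + 1) ^ 2)
       / (evens (j - K) * odds (j + K + 2)) = q ^ 2 * v * (1 - u) ^ 2 * (1 - u * u * v * q ^ 3) * S"
  proof -
    have "(1 - q ^ (2 * K + 1)) ^ 2 * (odds K / evens K) ^ 2 = (odds k / evens k) ^ 2 * (1 - u) ^ 2"
      using nz by (simp add: k_def odds_Suc evens_Suc u_def power_mult_distrib power_divide)
    then have *: "(1 - q ^ (2 * K + 1)) ^ 2 * (odds K / evens K) ^ 2 * q ^ (2 * (K + 1) ^ 2) = B * (1 - u) ^ 2"
      unfolding K B_def by (simp add: mult_ac)
    have **: "j + K + 2 = j + k + 1" "q ^ (2 * Suc r) = q ^ 2 * v" by (auto simp: k_def v_def power2_eq_square)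
    have "q ^ (2 * (j - K)) * (1 - q ^ (2 * K + 1)) ^ 2 * (odds K / evens K) ^ 2 * q ^ (2 * (K + 1) ^ 2)
       / (evens (j - K) * odds (j + K + 2)) =
       q ^ 2 * v * ((1 - q ^ (2 * K + 1)) ^ 2 * (odds K / evens K) ^ 2 * q ^ (2 * (K + 1) ^ 2)) / (evens (Suc r) * odds (j + k + 1))"
      unfolding d ** by (simp only: mult.assoc)
    also have "\<dots> = q ^ 2 * v * (1 - u) ^ 2 * (1 - u * u * v * q ^ 3) * S"
      unfolding * S_def o e using nz by (simp add: mult_ac)
    finally show ?thesis .
  qed
  moreover have "q ^ (2 * (j - k)) * (1 - q ^ (2 * k + 1)) ^ 2 * (odds k / evens k) ^ 2 * q ^ (2 * (k + 1) ^ 2)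
       / (evens (j - k) * odds (j + k + 2)) = v * (1 - u * q) ^ 2 * u * u * q ^ 2 * (1 - q ^ 2 * v) * S"
  proof -
    have "q ^ (2 * (k + 1) ^ 2) = q ^ (2 * k ^ 2) * (u * u * q ^ 2)"
      by (simp add: u_def power2_eq_square algebra_simps flip: power_add)
    moreover have "q ^ (2 * k + 1) = u * q" by (simp add: u_def)
    ultimately show ?thesis
      unfolding d S_def B_def v_def[symmetric] using nz by (simp add: mult_ac)
  qed
  moreover have "- (q ^ 2 * v * (1 - u) ^ 2 * (1 - u * u * v * q ^ 3) * S)
      + ((1 - u * v * q ^ 2) ^ 2 * (1 - u * u * q) * S - (1 - u * u * q) * (1 - q ^ 2 * v) * (1 - u * u * v * q ^ 3) * S)
      = - (v * (1 - u * q) ^ 2 * u * u * q ^ 2 * (1 - q ^ 2 * v) * S)"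
    by algebra
  ultimately show ?case
    unfolding sum.atMost_Suc Suc.IH[OF Suc_leD[OF Suc.prems]]
    unfolding k_def[symmetric] by (simp only:)
qed

text \<open>A Bailey pair relative to a = q in base q^2: the terminating 6phi5 sum with a = b = q
  and c sent to infinity. The denominator \<open>odds (j + k + 1)\<close> is (a q^2;q^2)_{j+k} times
  1 - q, which cancels the denominator of the very-well-poised factor.\<close>

lemma bailey_sum:
  "(\<Sum>k\<le>j. (1 - q ^ (4 * k + 1)) * (odds k / evens k) ^ 2 * q ^ (2 * k ^ 2) / (evens (j - k) * odds (j + k + 1)))
    = 1 / evens j ^ 2"
proof (induction j)
  case 0
  have "1 - q \<noteq> 0" using one_minus_q_power[of 1] by simp
  then show ?case by (simp add: odds_Suc)
next
  case (Suc j)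
  define t where "t j k = (1 - q ^ (4 * k + 1)) * (odds k / evens k) ^ 2 * q ^ (2 * k ^ 2) / (evens (j - k) * odds (j + k + 1))" for j k
  define c where "c = (1 - q ^ (2 * j + 2)) ^ 2"
  have c: "c \<noteq> 0" using q_power[of "2*j+2"] by (simp add: c_def del: power_Suc add_2_eq_Suc')
  \<comment> \<open>The term that only the longer sum has; it is cancelled by the companion at
    \<open>K = j\<close>.\<close>
  have "c * t (Suc j) (Suc j) = (1 - q ^ (2 * j + 1)) ^ 2 * (odds j / evens j) ^ 2 * q ^ (2 * (j + 1) ^ 2) / odds (j + j + 2)"
  proof -
    have "Suc j + Suc j + 1 = Suc (j + j + 2)" "2 * (j + j + 2) + 1 = 4 * Suc j + 1" by simp_all
    then have "odds (Suc j + Suc j + 1) = odds (j + j + 2) * (1 - q ^ (4 * Suc j + 1))"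
      by (metis odds_Suc)
    moreover have "c * (odds (Suc j) / evens (Suc j)) ^ 2 = (1 - q ^ (2 * j + 1)) ^ 2 * (odds j / evens j) ^ 2"
      using c unfolding odds_Suc evens_Suc c_def by (simp add: power_mult_distrib power_divide del: power_Suc add_2_eq_Suc')
    ultimately show ?thesis
      unfolding t_def using one_minus_q_power[of "4 * Suc j + 1"]
      by (simp add: mult_ac del: power_Suc)
  qed
  moreover have "(\<Sum>k\<le>j. c * t (Suc j) k - t j k) =
    - ((1 - q ^ (2 * j + 1)) ^ 2 * (odds j / evens j) ^ 2 * q ^ (2 * (j + 1) ^ 2) / odds (j + j + 2))"
    using bailey_partial[of j j] by (simp add: t_def c_def)
  ultimately have "c * (\<Sum>k\<le>j. t (Suc j) k) - (\<Sum>k\<le>j. t j k) = - (c * t (Suc j) (Suc j))"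
    by (simp only: sum_subtractf sum_distrib_left)
  then have "c * (\<Sum>k\<le>Suc j. t (Suc j) k) = (\<Sum>k\<le>j. t j k)"
    unfolding sum.atMost_Suc distrib_left by (simp only: diff_eq_eq) simp
  then have "(\<Sum>k\<le>Suc j. t (Suc j) k) = (\<Sum>k\<le>j. t j k) / c"
    using c by (simp add: field_simps)
  also have "\<dots> = 1 / evens (Suc j) ^ 2"
    using Suc.IH unfolding evens_Suc c_def t_def[symmetric] by (simp add: power_mult_distrib)
  finally show ?case by (simp add: t_def)
qed

subsection \<open>The exact identity\<close>

lemma odds_add: "qpoch (q ^ (2 * k + 1)) (q ^ 2) i = odds (k + i) / odds k"
  using qpoch_add[of q "q^2" k i] odds_nonzero[of k] by (simp add: odds_def field_simps flip: power_mult)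

lemma evens_add: "qpoch (q ^ (2 * k + 2)) (q ^ 2) i = evens (k + i) / evens k"
proof -
  have "q ^ (2 * k + 2) = q ^ 2 * (q ^ 2) ^ k" by (simp only: power_add power_mult mult.commute[of "q ^ 2"])
  then show ?thesis
    using qpoch_add[of "q^2" "q^2" k i] evens_nonzero[of k] by (simp add: evens_def)
qed

text \<open>The products over \<open>X - p ^ l\<close> in the Saalschuetz sum at X = q^(2m), where p
  = q^2: each factor yields its smaller power of q and a sign, and the remaining factors are those
  of \<open>evens\<close> in reverse. \<open>prod_odd_powers\<close> does the same for
  \<open>X - A * p ^ l\<close>.\<close>

lemma prod_even_powers:
  assumes "L \<le> m"
  shows "(\<Prod>l<L. q ^ (2 * m) - (q ^ 2) ^ l) = (-1) ^ L * q ^ (L * (L - 1)) * evens m / evens (m - L)"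
  using assms
proof (induction L)
  case (Suc L)
  then obtain r where m: "m = Suc (L + r)" by (metis Suc_le_lessD less_iff_Suc_add)
  have "Suc L * (Suc L - 1) = L * (L - 1) + 2 * L" by (cases L) simp_all
  then have *: "q ^ (Suc L * (Suc L - 1)) = q ^ (L * (L - 1)) * q ^ (2 * L)"
    by (simp only: power_add)
  define U where "U = 1 - q ^ (2 * r + 2)"
  have X: "q ^ (2 * m) - (q ^ 2) ^ L = - (q ^ (2 * L)) * U"
    by (simp add: m U_def algebra_simps flip: power_mult power_add)
  have r: "m - L = Suc r" "m - Suc L = r" using m by auto
  have "U \<noteq> 0" unfolding U_def by (rule one_minus_q_power) simp
  then show ?case
    unfolding prod.lessThan_Suc * Suc.IH[OF Suc_leD[OF Suc.prems]] X r evens_Suc U_def[symmetric]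
    by simp
qed simp

lemma prod_odd_powers:
  "(\<Prod>l<r. q ^ (2 * (k + r)) - q ^ (2 * k + 1) * (q ^ 2) ^ l) = (-1) ^ r * q ^ (2 * k * r + r ^ 2) * odds r"
proof -
  \<comment> \<open>The number of factors is separated from \<open>r\<close>, which also occurs
    inside each factor and must stay fixed during the induction.\<close>
  have "(\<Prod>l<L. q ^ (2 * (k + r)) - q ^ (2 * k + 1) * (q ^ 2) ^ l) = (-1) ^ L * q ^ (2 * k * L + L ^ 2) * odds r / odds (r - L)"
    if "L \<le> r" for L
    using that
  proof (induction L)
    case (Suc L)
    then obtain s where r: "r = Suc (L + s)" by (metis Suc_le_lessD less_iff_Suc_add)
    have *: "q ^ (2 * k * Suc L + Suc L ^ 2) = q ^ (2 * k * L + L ^ 2) * q ^ (2 * k + 2 * L + 1)"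
      by (simp add: power2_eq_square algebra_simps flip: power_add)
    define U where "U = 1 - q ^ (2 * s + 1)"
    have X: "q ^ (2 * (k + r)) - q ^ (2 * k + 1) * (q ^ 2) ^ L = - (q ^ (2 * k + 2 * L + 1)) * U"
      by (simp add: r U_def algebra_simps flip: power_mult power_add)
    have r: "r - L = Suc s" "r - Suc L = s" using r by auto
    have "U \<noteq> 0" unfolding U_def by (rule one_minus_q_power) simp
    then show ?case
      unfolding prod.lessThan_Suc * Suc.IH[OF Suc_leD[OF Suc.prems]] X r odds_Suc U_def[symmetric]
      by simp
  qed simp
  from this[of r] show ?thesis by simp
qed

text \<open>With j = k + i this is q-Saalschuetz in base q^2 of length m - k, for A = q^(2k+1), D =
  q^(2k+2), X = q^(2m). It provides the conjugate Bailey pair for \<open>exact_sum\<close>.\<close>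

lemma saalschuetz_sum:
  assumes "k \<le> m"
  shows "(\<Sum>j=k..m. (-1) ^ (m - j) * q ^ ((m - j) * (m - j - 1)) * odds j * evens (m + j) /
        (evens j * evens (m - j)) / (evens (j - k) * odds (j + k + 1)))
    = (-1) ^ (m - k) * q ^ (m ^ 2 - k ^ 2) * odds k * evens (m + k) * odds (m - k) /
        (evens k * evens (m - k) * odds (m + k + 1))"
proof -
  obtain r where m: "m = k + r" using assms less_eqE by blast
  let ?A = "q ^ (2 * k + 1)" and ?D = "q ^ (2 * k + 2)" and ?X = "q ^ (2 * m)"
  have AD: "?A * ?D = q ^ (2 * (2 * k + 1) + 1)" and XD: "?X * ?D = q ^ (2 * (m + k) + 2)"
    by (simp_all add: algebra_simps flip: power_add)
  have p: "(q ^ 2) ^ i \<noteq> 1" if "i > 0" for i using q_power[of "2*i"] that by (simp add: power_mult)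
  have C: "qpoch (?A * ?D) (q ^ 2) i \<noteq> 0" for i unfolding AD odds_add by simp
  have "(\<Sum>i\<le>r. qpoch ?A (q^2) i * qpoch (?X * ?D) (q^2) i * (\<Prod>l<r-i. ?X - (q^2) ^ l) /
      (qpoch (q^2) (q^2) i * qpoch (q^2) (q^2) (r - i) * qpoch (?A * ?D) (q^2) i))
    = qpoch ?D (q^2) r * (\<Prod>l<r. ?X - ?A * (q^2) ^ l) / (qpoch (q^2) (q^2) r * qpoch (?A * ?D) (q^2) r)"
    by (rule q_saalschuetz[OF p C])
  also have "\<dots> = evens m * (-1) ^ r * q ^ (2 * k * r + r ^ 2) * odds r * odds (2 * k + 1) / (evens k * evens r * odds (m + k + 1))"
  proof -
    have *: "2 * k + 1 + r = m + k + 1" by (simp add: m)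
    show ?thesis
      unfolding AD odds_add evens_add evens_def[symmetric] * unfolding m prod_odd_powers by (simp add: mult_ac)
  qed
  also have "(\<Sum>i\<le>r. qpoch ?A (q^2) i * qpoch (?X * ?D) (q^2) i * (\<Prod>l<r-i. ?X - (q^2) ^ l) /
      (qpoch (q^2) (q^2) i * qpoch (q^2) (q^2) (r - i) * qpoch (?A * ?D) (q^2) i))
    = (\<Sum>i\<le>r. evens m * odds (2 * k + 1) / (odds k * evens (m + k)) * 
        ((-1) ^ (m - (k+i)) * q ^ ((m - (k+i)) * (m - (k+i) - 1)) * odds (k+i) * evens (m + (k+i)) /
        (evens (k+i) * evens (m - (k+i))) / (evens (k+i - k) * odds (k+i + k + 1))))"
  proof (rule sum.cong[OF refl])
    fix i assume "i \<in> {..r}"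
    then have i: "m - (k + i) = r - i" "r - i \<le> m" "m - (r - i) = k + i" "k + i - k = i"
      "2 * k + 1 + i = k + i + k + 1" "m + k + i = m + (k + i)"
      by (auto simp: m)
    show "qpoch ?A (q^2) i * qpoch (?X * ?D) (q^2) i * (\<Prod>l<r-i. ?X - (q^2) ^ l) /
      (qpoch (q^2) (q^2) i * qpoch (q^2) (q^2) (r - i) * qpoch (?A * ?D) (q^2) i)
      = evens m * odds (2 * k + 1) / (odds k * evens (m + k)) * 
        ((-1) ^ (m - (k+i)) * q ^ ((m - (k+i)) * (m - (k+i) - 1)) * odds (k+i) * evens (m + (k+i)) /
        (evens (k+i) * evens (m - (k+i))) / (evens (k+i - k) * odds (k+i + k + 1)))"
      unfolding AD XD odds_add evens_add prod_even_powers[OF i(2)] i evens_def[symmetric] by (simp add: mult_ac)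
  qed
  also have "\<dots> = evens m * odds (2 * k + 1) / (odds k * evens (m + k)) * (\<Sum>j=k..m. (-1) ^ (m - j) * q ^ ((m - j) * (m - j - 1)) * odds j * evens (m + j) /
        (evens j * evens (m - j)) / (evens (j - k) * odds (j + k + 1)))"
    unfolding sum_distrib_left[symmetric] 
    by (rule arg_cong[where f = "\<lambda>x. _ * x"], rule sum.reindex_bij_witness[of _ "\<lambda>j. j - k" "\<lambda>i. k + i"]) (auto simp: m)
  finally have *: "evens m * odds (2 * k + 1) / (odds k * evens (m + k)) * (\<Sum>j=k..m. (-1) ^ (m - j) * q ^ ((m - j) * (m - j - 1)) * odds j * evens (m + j) /
        (evens j * evens (m - j)) / (evens (j - k) * odds (j + k + 1))) = 
     evens m * (-1) ^ r * q ^ (2 * k * r + r ^ 2) * odds r * odds (2 * k + 1) / (evens k * evens r * odds (m + k + 1))" .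
  have r: "m - k = r" "m ^ 2 - k ^ 2 = 2 * k * r + r ^ 2" by (simp_all add: m power2_eq_square algebra_simps)
  have "S = b * (odds k * evens (m + k)) / (evens m * odds (2 * k + 1))"
    if "evens m * odds (2 * k + 1) / (odds k * evens (m + k)) * S = b" for S b
    using that by (auto simp: divide_simps mult_ac)
  from this[OF *] show ?thesis unfolding r by (simp add: mult_ac)
qed

text \<open>Bailey's transform: expand the left-hand side by \<open>saalschuetz_sum\<close>,
  exchange the two summations, and evaluate the new inner sum by \<open>bailey_sum\<close>.\<close>

lemma exact_sum:
  "(\<Sum>k\<le>m. (1 - q ^ (4 * k + 1)) * (odds k / evens k) ^ 3 * (-1) ^ (m - k) * q ^ (m ^ 2 + k ^ 2) *
      evens (m + k) * odds (m - k) / (evens (m - k) * odds (m + k + 1)))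
   = (\<Sum>j\<le>m. (-1) ^ (m - j) * q ^ ((m - j) * (m - j - 1)) * odds j * evens (m + j) / (evens j ^ 3 * evens (m - j)))"
proof -
  define a where "a k = (1 - q ^ (4 * k + 1)) * (odds k / evens k) ^ 2 * q ^ (2 * k ^ 2)" for k
  define g where "g j = (-1) ^ (m - j) * q ^ ((m - j) * (m - j - 1)) * odds j * evens (m + j) / (evens j * evens (m - j))" for j
  have "(\<Sum>k\<le>m. (1 - q ^ (4 * k + 1)) * (odds k / evens k) ^ 3 * (-1) ^ (m - k) * q ^ (m ^ 2 + k ^ 2) *
      evens (m + k) * odds (m - k) / (evens (m - k) * odds (m + k + 1)))
    = (\<Sum>k\<le>m. \<Sum>j=k..m. a k * (g j / (evens (j - k) * odds (j + k + 1))))"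
  proof (rule sum.cong[OF refl])
    fix k assume "k \<in> {..m}"
    then have k: "k \<le> m" by simp
    then have "k ^ 2 \<le> m ^ 2" by (rule power_mono) simp
    then have "m ^ 2 + k ^ 2 = 2 * k ^ 2 + (m ^ 2 - k ^ 2)" by simp
    then have *: "q ^ (m ^ 2 + k ^ 2) = q ^ (2 * k ^ 2) * q ^ (m ^ 2 - k ^ 2)" by (simp only: power_add)
    show "(1 - q ^ (4 * k + 1)) * (odds k / evens k) ^ 3 * (-1) ^ (m - k) * q ^ (m ^ 2 + k ^ 2) *
      evens (m + k) * odds (m - k) / (evens (m - k) * odds (m + k + 1)) =
      (\<Sum>j=k..m. a k * (g j / (evens (j - k) * odds (j + k + 1))))"
      unfolding sum_distrib_left[symmetric] g_def saalschuetz_sum[OF k] a_def *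
      by (simp add: power2_eq_square power3_eq_cube mult_ac)
  qed
  also have "\<dots> = (\<Sum>j\<le>m. \<Sum>k\<le>j. a k * (g j / (evens (j - k) * odds (j + k + 1))))"
  proof -
    have "(\<Sum>k\<le>m. \<Sum>j=k..m. h k j) = (\<Sum>j\<le>m. \<Sum>k\<le>j. h k j)" for h :: "nat \<Rightarrow> nat \<Rightarrow> 'a"
      unfolding sum.Sigma[OF finite_atMost ballI[OF finite_atLeastAtMost]] sum.Sigma[OF finite_atMost ballI[OF finite_atMost]]
      by (rule sum.reindex_bij_witness[of _ "\<lambda>(x,y). (y,x)" "\<lambda>(x,y). (y,x)"]) auto
    then show ?thesis .
  qed
  also have "\<dots> = (\<Sum>j\<le>m. g j * (\<Sum>k\<le>j. a k / (evens (j - k) * odds (j + k + 1))))"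
    by (simp add: sum_distrib_left mult_ac)
  also have "\<dots> = (\<Sum>j\<le>m. g j * (1 / evens j ^ 2))"
    unfolding a_def bailey_sum ..
  also have "\<dots> = (\<Sum>j\<le>m. (-1) ^ (m - j) * q ^ ((m - j) * (m - j - 1)) * odds j * evens (m + j) / (evens j ^ 3 * evens (m - j)))"
    by (simp add: g_def power3_eq_cube power2_eq_square mult_ac)
  finally show ?thesis .
qed

section \<open>The deformed products at x = q^(2m+1)\<close>

definition num_prod :: "'a \<Rightarrow> nat \<Rightarrow> 'a" where
  "num_prod x k = (\<Prod>j<k. (1 - x * q ^ (2 * j + 1)) * (1 - q ^ (2 * j + 1) / x))"

definition quot_prod :: "'a \<Rightarrow> nat \<Rightarrow> 'a" where
  "quot_prod x k = (\<Prod>j<k. (1 - x * q ^ (2 * j + 1)) * (1 - q ^ (2 * j + 1) / x) /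
     ((1 - x * q ^ (2 * j + 2)) * (1 - q ^ (2 * j + 2) / x)))"

text \<open>Here q/x = q^(-2m), so the k factors with 1/x contribute negative powers of q;
  \<open>q ^ (2 * m * k)\<close> clears them.\<close>

lemma num_prod_eq:
  assumes "k \<le> m"
  shows "num_prod (q ^ (2 * m + 1)) k * q ^ (2 * m * k) = (-1) ^ k * q ^ (k * (k - 1)) * evens (m + k) / evens (m - k)"
  using assms
proof (induction k)
  case 0
  then show ?case by (simp add: num_prod_def)
next
  case (Suc k)
  then obtain r where m: "m = Suc (k + r)" by (metis Suc_le_lessD less_iff_Suc_add)
  have r: "m - k = Suc r" "m - Suc k = r" "m + Suc k = Suc (m + k)" using m by auto
  have "Suc k * (Suc k - 1) = k * (k - 1) + 2 * k" by (cases k) simp_all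
  then have *: "q ^ (Suc k * (Suc k - 1)) = q ^ (k * (k - 1)) * q ^ (2 * k)"
    by (simp only: power_add)
  have **: "q ^ (2 * m * Suc k) = q ^ (2 * m * k) * q ^ (2 * m)" by (simp add: power_add mult.commute)
  define U where "U = 1 - q ^ (2 * r + 2)"
  define V where "V = 1 - q ^ (2 * (m + k) + 2)"
  have X: "1 - q ^ (2 * m + 1) * q ^ (2 * k + 1) = V"
    unfolding V_def power_add[symmetric] by (simp add: algebra_simps)
  have "q ^ (2 * m + 1) = q ^ (2 * k + 1) * q ^ (2 * r + 2)" 
    unfolding m power_add[symmetric] by (rule arg_cong[where f = "power q"]) simp
  then have "q ^ (2 * k + 1) / q ^ (2 * m + 1) * q ^ (2 * r + 2) = 1" by simp
  note e1 = this
  have e2: "q ^ (2 * m) = q ^ (2 * k) * q ^ (2 * r + 2)" 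
    unfolding m power_add[symmetric] by (rule arg_cong[where f = "power q"]) simp
  have aux1: "(1 - t) * a = - b * (1 - w)" if "t * w = 1" "a = b * w" for t a b w :: 'a
    using that by algebra
  have Y: "(1 - q ^ (2 * k + 1) / q ^ (2 * m + 1)) * q ^ (2 * m) = - (q ^ (2 * k)) * U"
    unfolding U_def by (rule aux1[OF e1 e2])
  have nz: "U \<noteq> 0" unfolding U_def by (rule one_minus_q_power) simp
  have "num_prod (q ^ (2 * m + 1)) (Suc k) * q ^ (2 * m * Suc k) =
      (num_prod (q ^ (2 * m + 1)) k * q ^ (2 * m * k)) * V * ((1 - q ^ (2 * k + 1) / q ^ (2 * m + 1)) * q ^ (2 * m))"
    unfolding num_prod_def prod.lessThan_Suc ** X by (simp only: mult_ac)
  also have "\<dots> = (-1) ^ Suc k * q ^ (Suc k * (Suc k - 1)) * evens (m + Suc k) / evens (m - Suc k)"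
    unfolding Suc.IH[OF Suc_leD[OF Suc.prems]] Y * r evens_Suc U_def[symmetric] V_def[symmetric] using nz by simp
  finally show ?case .
qed

text \<open>Rewriting 1 - t as -t (1 - 1/t) in the factors with 1/x leaves a surplus 1/q for each
  index, hence \<open>q ^ k\<close>. The factor 1 - x appears because (x q^2;q^2)_k begins after
  \<open>odds (m + 1)\<close>, which is \<open>odds m\<close> times 1 - x.\<close>

lemma quot_prod_eq:
  assumes "k \<le> m"
  shows "quot_prod (q ^ (2 * m + 1)) k * q ^ k =
    (1 - q ^ (2 * m + 1)) * evens (m + k) * odds (m - k) / (evens (m - k) * odds (m + k + 1))"
  using assms
proof (induction k)
  case 0
  have "1 - q ^ (2 * m + 1) \<noteq> 0" by (rule one_minus_q_power) simp
  then show ?case by (simp add: quot_prod_def odds_Suc del: power_Suc)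
next
  case (Suc k)
  then obtain r where m: "m = Suc (k + r)" by (metis Suc_le_lessD less_iff_Suc_add)
  have r: "m - k = Suc r" "m - Suc k = r" "m + Suc k = Suc (m + k)" "Suc (m + k) + 1 = Suc (m + k + 1)" using m by auto
  define U where "U = 1 - q ^ (2 * r + 2)"
  define V where "V = 1 - q ^ (2 * (m + k) + 2)"
  define U' where "U' = 1 - q ^ (2 * r + 1)"
  define V' where "V' = 1 - q ^ (2 * (m + k + 1) + 1)"
  have X: "1 - q ^ (2 * m + 1) * q ^ (2 * k + 1) = V" "1 - q ^ (2 * m + 1) * q ^ (2 * k + 2) = V'"
    unfolding V_def V'_def power_add[symmetric] by (simp_all add: algebra_simps)
  have "q ^ (2 * m + 1) = q ^ (2 * k + 1) * q ^ (2 * r + 2)" "q ^ (2 * m + 1) = q ^ (2 * k + 2) * q ^ (2 * r + 1)" 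
    unfolding m power_add[symmetric] by (rule arg_cong[where f = "power q"], simp)+
  then have w: "q ^ (2 * k + 1) / q ^ (2 * m + 1) * q ^ (2 * r + 2) = 1" "q ^ (2 * k + 2) / q ^ (2 * m + 1) * q ^ (2 * r + 1) = 1" 
    by simp_all
  then have Y: "1 - q ^ (2 * k + 1) / q ^ (2 * m + 1) = - (q ^ (2 * k + 1) / q ^ (2 * m + 1)) * U"
    "1 - q ^ (2 * k + 2) / q ^ (2 * m + 1) = - (q ^ (2 * k + 1) * q / q ^ (2 * m + 1)) * U'"
  proof -
    have aux: "1 - t = - t * (1 - w)" if "t * w = 1" for t w :: 'a
      using that by algebra
    have "q ^ (2 * k + 2) = q ^ (2 * k + 1) * q" by simp
    then show "1 - q ^ (2 * k + 1) / q ^ (2 * m + 1) = - (q ^ (2 * k + 1) / q ^ (2 * m + 1)) * U"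
      "1 - q ^ (2 * k + 2) / q ^ (2 * m + 1) = - (q ^ (2 * k + 1) * q / q ^ (2 * m + 1)) * U'"
      using w aux unfolding U_def U'_def by metis+
  qed
  have nz: "U \<noteq> 0" "U' \<noteq> 0" "V' \<noteq> 0" unfolding U_def U'_def V'_def by (rule one_minus_q_power, simp)+
  define z where "z = q ^ (2 * k + 1) / q ^ (2 * m + 1)"
  have z: "z \<noteq> 0" "q ^ (2 * k + 1) * q / q ^ (2 * m + 1) = z * q" by (simp_all add: z_def)
  have Z: "V * (- z * U) / (V' * (- (z * q) * U')) * q = V * U / (V' * U')"
    using nz z by simp
  have "quot_prod (q ^ (2 * m + 1)) (Suc k) * q ^ Suc k =
      (quot_prod (q ^ (2 * m + 1)) k * q ^ k) * (V * (- z * U) / (V' * (- (z * q) * U')) * q)"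
    unfolding quot_prod_def prod.lessThan_Suc X Y
    unfolding z(2) z_def[symmetric] by (simp only: mult_ac power_Suc)
  also have "\<dots> = (1 - q ^ (2 * m + 1)) * evens (m + Suc k) * odds (m - Suc k) / (evens (m - Suc k) * odds (m + Suc k + 1))"
    unfolding Suc.IH[OF Suc_leD[OF Suc.prems]] Z r evens_Suc odds_Suc U_def[symmetric] V_def[symmetric] U'_def[symmetric] V'_def[symmetric] 
    using nz by simp
  finally show ?case .
qed

text \<open>Watson's transformation in base q^2 with a = q, further parameters q, q, x q, q/x and
  one sent to infinity; it terminates as q/x = (q^2)^(-m). Both sides are matched with
  \<open>exact_sum\<close>, up to the factor (-1)^m q^(m^2).\<close>

lemma watson_special:
  fixes m defines "x \<equiv> q ^ (2 * m + 1)"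
  shows "(\<Sum>k\<le>m. (-1) ^ k * (1 - q ^ (4 * k + 1)) * (odds k / evens k) ^ 3 * quot_prod x k * q ^ (k ^ 2 + k)) * q ^ m
    = (1 - x) * (\<Sum>k\<le>m. odds k / evens k ^ 3 * num_prod x k * q ^ (2 * k))"
proof -
  have x: "1 - x \<noteq> 0" unfolding x_def by (rule one_minus_q_power) simp
  have "(\<Sum>k\<le>m. (1 - q ^ (4 * k + 1)) * (odds k / evens k) ^ 3 * (-1) ^ (m - k) * q ^ (m ^ 2 + k ^ 2) *
      evens (m + k) * odds (m - k) / (evens (m - k) * odds (m + k + 1)))
    = (-1) ^ m * q ^ m ^ 2 / (1 - x) * 
      (\<Sum>k\<le>m. (-1) ^ k * (1 - q ^ (4 * k + 1)) * (odds k / evens k) ^ 3 * quot_prod x k * q ^ (k ^ 2 + k))"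
    unfolding sum_distrib_left
  proof (rule sum.cong[OF refl])
    fix k assume "k \<in> {..m}"
    then have k: "k \<le> m" by simp
    define c where "c = (1 - q ^ (4 * k + 1)) * (odds k / evens k) ^ 3"
    have "(-1::'a) ^ (m - k) = (-1) ^ m * (-1) ^ k"
      using k by (simp add: minus_one_power_iff)
    moreover have "evens (m + k) * odds (m - k) / (evens (m - k) * odds (m + k + 1)) = quot_prod x k * q ^ k / (1 - x)"
      unfolding x_def quot_prod_eq[OF k] using x by (simp add: x_def)
    moreover have "c * (-1) ^ (m - k) * q ^ (m ^ 2 + k ^ 2) * evens (m + k) * odds (m - k) / (evens (m - k) * odds (m + k + 1))
      = c * (-1) ^ (m - k) * q ^ m ^ 2 * q ^ k ^ 2 * (evens (m + k) * odds (m - k) / (evens (m - k) * odds (m + k + 1)))"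
      by (simp add: power_add mult_ac)
    ultimately show "(1 - q ^ (4 * k + 1)) * (odds k / evens k) ^ 3 * (-1) ^ (m - k) * q ^ (m ^ 2 + k ^ 2) *
      evens (m + k) * odds (m - k) / (evens (m - k) * odds (m + k + 1)) =
      (-1) ^ m * q ^ m ^ 2 / (1 - x) * ((-1) ^ k * (1 - q ^ (4 * k + 1)) * (odds k / evens k) ^ 3 * quot_prod x k * q ^ (k ^ 2 + k))"
      unfolding c_def[symmetric] by (simp add: c_def power_add mult_ac)
  qed
  moreover have "(\<Sum>j\<le>m. (-1) ^ (m - j) * q ^ ((m - j) * (m - j - 1)) * odds j * evens (m + j) / (evens j ^ 3 * evens (m - j)))
    * q ^ m = (-1) ^ m * q ^ m ^ 2 * (\<Sum>k\<le>m. odds k / evens k ^ 3 * num_prod x k * q ^ (2 * k))"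
    unfolding sum_distrib_left sum_distrib_right
  proof (rule sum.cong[OF refl])
    fix k assume "k \<in> {..m}"
    then obtain r where m: "m = k + r" using less_eqE by auto
    then have k: "k \<le> m" by simp
    have s: "(-1::'a) ^ (m - k) = (-1) ^ m * (-1) ^ k"
      using k by (simp add: minus_one_power_iff)
    have "(m - k) * (m - k - 1) + m + 2 * m * k = m ^ 2 + 2 * k + k * (k - 1)"
      by (cases r; cases k) (simp_all add: m power2_eq_square algebra_simps)
    then have "q ^ ((m - k) * (m - k - 1)) * q ^ m * q ^ (2 * m * k) = q ^ (m ^ 2) * q ^ (2 * k) * q ^ (k * (k - 1))"
      unfolding power_add[symmetric] by simp
    then have e: "q ^ ((m - k) * (m - k - 1)) * q ^ m = q ^ (m ^ 2) * q ^ (2 * k) * (q ^ (k * (k - 1)) / q ^ (2 * m * k))"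
      by (simp add: divide_simps)
    have n: "num_prod x k = (-1) ^ k * (q ^ (k * (k - 1)) / q ^ (2 * m * k)) * (evens (m + k) / evens (m - k))"
      using num_prod_eq[OF k, folded x_def] by (simp add: divide_simps mult.assoc)
    show "(-1) ^ (m - k) * q ^ ((m - k) * (m - k - 1)) * odds k * evens (m + k) / (evens k ^ 3 * evens (m - k)) * q ^ m
      = (-1) ^ m * q ^ m ^ 2 * (odds k / evens k ^ 3 * num_prod x k * q ^ (2 * k))"
    proof -
      have "(-1) ^ (m - k) * q ^ ((m - k) * (m - k - 1)) * odds k * evens (m + k) / (evens k ^ 3 * evens (m - k)) * q ^ m
        = (-1) ^ (m - k) * (q ^ ((m - k) * (m - k - 1)) * q ^ m) * (odds k / evens k ^ 3) * (evens (m + k) / evens (m - k))"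
        by (simp add: mult_ac)
      then show ?thesis unfolding s e n by (simp add: mult_ac)
    qed
  qed
  moreover have "(-1) ^ m * q ^ m ^ 2 \<noteq> (0::'a)" by simp
  moreover have "F * u = (1 - x) * H" if "J = c / (1 - x) * F" "J * u = c * H" "c \<noteq> 0" for F H J c u
  proof -
    have "c * (F * u) = J * (1 - x) * u" using that(1) x by simp
    also have "\<dots> = c * ((1 - x) * H)" using that(2) by algebra
    finally show ?thesis using that(3) by simp
  qed
  ultimately show ?thesis unfolding exact_sum by blast
qed

end

subsection \<open>Orders of vanishing at roots of unity\<close>

definition cpoly :: "int poly \<Rightarrow> complex poly" where
  "cpoly = map_poly complex_of_int"

lemma cpoly_mult: "cpoly (p * r) = cpoly p * cpoly r"
  and cpoly_add: "cpoly (p + r) = cpoly p + cpoly r"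
  by (simp_all add: cpoly_def of_int_poly_mult of_int_poly_add)

lemma cpoly_1 [simp]: "cpoly 1 = 1" and cpoly_0 [simp]: "cpoly 0 = 0"
  by (simp_all add: cpoly_def)

lemma cpoly_uminus: "cpoly (- p) = - cpoly p"
  by (auto simp: cpoly_def poly_eq_iff coeff_map_poly)

lemma cpoly_power: "cpoly (p ^ k) = cpoly p ^ k"
  by (induction k) (simp_all add: cpoly_mult)

lemma cpoly_X [simp]: "cpoly [:0, 1:] = [:0, 1:]"
  by (simp add: cpoly_def map_poly_pCons)

definition has_value :: "complex \<Rightarrow> ratfun \<Rightarrow> complex \<Rightarrow> bool" where
  "has_value z r c \<longleftrightarrow> (\<exists>N D. r = to_fract N / to_fract D \<and> poly (cpoly D) z \<noteq> 0 \<and>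
     c = poly (cpoly N) z / poly (cpoly D) z)"

text \<open>Zero of order at least \<open>e\<close> at \<open>z\<close>. Order 0 means that
  \<open>z\<close> is not a pole, which is all that is asked of a cofactor.\<close>

definition vanishes :: "complex \<Rightarrow> nat \<Rightarrow> ratfun \<Rightarrow> bool" where
  "vanishes z e r \<longleftrightarrow> (\<exists>N D. r = to_fract N / to_fract D \<and> poly (cpoly D) z \<noteq> 0 \<and>
     [:- z, 1:] ^ e dvd cpoly N)"

lemma vanishes_0_iff: "vanishes z 0 r \<longleftrightarrow> (\<exists>c. has_value z r c)"
  by (auto simp: vanishes_def has_value_def)

lemma vanishes_1_iff: "vanishes z (Suc 0) r \<longleftrightarrow> has_value z r 0"
  by (auto simp: vanishes_def has_value_def poly_eq_0_iff_dvd)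

lemma has_value_imp_vanishes: "has_value z r c \<Longrightarrow> vanishes z 0 r"
  by (auto simp: vanishes_0_iff)

lemma vanishes_mono: "vanishes z e r \<Longrightarrow> f \<le> e \<Longrightarrow> vanishes z f r"
  unfolding vanishes_def using power_le_dvd by blast

lemma cpoly_nonzero: "poly (cpoly D) z \<noteq> 0 \<Longrightarrow> to_fract D \<noteq> 0"
  by auto

lemma has_value_to_fract: "has_value z (to_fract p) (poly (cpoly p) z)"
  unfolding has_value_def by (intro exI[of _ p] exI[of _ 1]) simp

lemma has_value_1 [simp]: "has_value z 1 1"
  using has_value_to_fract[of z 1] by simp

lemma has_value_0 [simp]: "has_value z 0 0"
  using has_value_to_fract[of z 0] by simp

lemma has_value_qvar [simp]: "has_value z qvar z"
  using has_value_to_fract[of z "[:0, 1:]"] by (simp add: qvar_def)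

lemma has_value_uminus: "has_value z r c \<Longrightarrow> has_value z (- r) (- c)"
  unfolding has_value_def
proof (elim exE conjE)
  fix N D assume "r = to_fract N / to_fract D" "poly (cpoly D) z \<noteq> 0" "c = poly (cpoly N) z / poly (cpoly D) z"
  then show "\<exists>N D. - r = to_fract N / to_fract D \<and> poly (cpoly D) z \<noteq> 0 \<and> - c = poly (cpoly N) z / poly (cpoly D) z"
    by (intro exI[of _ "- N"] exI[of _ D]) (simp add: cpoly_uminus)
qed

lemma has_value_add:
  assumes "has_value z r c" "has_value z s d" shows "has_value z (r + s) (c + d)"
proof -
  obtain N D N' D' where *: "r = to_fract N / to_fract D" "poly (cpoly D) z \<noteq> 0" "c = poly (cpoly N) z / poly (cpoly D) z"
    "s = to_fract N' / to_fract D'" "poly (cpoly D') z \<noteq> 0" "d = poly (cpoly N') z / poly (cpoly D') z"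
    using assms unfolding has_value_def by auto
  with cpoly_nonzero[of D z] cpoly_nonzero[of D' z] show ?thesis
    unfolding has_value_def
    by (intro exI[of _ "N * D' + N' * D"] exI[of _ "D * D'"]) (simp add: cpoly_mult cpoly_add add_frac_eq)
qed

lemma has_value_mult:
  assumes "has_value z r c" "has_value z s d" shows "has_value z (r * s) (c * d)"
proof -
  obtain N D N' D' where *: "r = to_fract N / to_fract D" "poly (cpoly D) z \<noteq> 0" "c = poly (cpoly N) z / poly (cpoly D) z"
    "s = to_fract N' / to_fract D'" "poly (cpoly D') z \<noteq> 0" "d = poly (cpoly N') z / poly (cpoly D') z"
    using assms unfolding has_value_def by auto
  then show ?thesis
    unfolding has_value_def
    by (intro exI[of _ "N * N'"] exI[of _ "D * D'"]) (simp add: cpoly_mult)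
qed

lemma has_value_diff: "has_value z r c \<Longrightarrow> has_value z s d \<Longrightarrow> has_value z (r - s) (c - d)"
  using has_value_add[of z r c "- s" "- d"] has_value_uminus by simp

lemma has_value_inverse:
  assumes "has_value z r c" "c \<noteq> 0" shows "has_value z (inverse r) (inverse c)"
proof -
  obtain N D where *: "r = to_fract N / to_fract D" "poly (cpoly D) z \<noteq> 0" "c = poly (cpoly N) z / poly (cpoly D) z"
    using assms unfolding has_value_def by auto
  then show ?thesis
    using \<open>c \<noteq> 0\<close> unfolding has_value_def by (intro exI[of _ D] exI[of _ N]) simp
qed

lemma has_value_divide:
  "has_value z r c \<Longrightarrow> has_value z s d \<Longrightarrow> d \<noteq> 0 \<Longrightarrow> has_value z (r / s) (c / d)"
  unfolding divide_inverse by (intro has_value_mult has_value_inverse)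

lemma has_value_power: "has_value z r c \<Longrightarrow> has_value z (r ^ k) (c ^ k)"
  by (induction k) (auto intro: has_value_mult)

lemma has_value_sum: "(\<And>i. i \<in> A \<Longrightarrow> has_value z (f i) (g i)) \<Longrightarrow> has_value z (sum f A) (sum g A)"
  by (induction A rule: infinite_finite_induct) (auto intro: has_value_add)

lemma has_value_prod: "(\<And>i. i \<in> A \<Longrightarrow> has_value z (f i) (g i)) \<Longrightarrow> has_value z (prod f A) (prod g A)"
  by (induction A rule: infinite_finite_induct) (auto intro: has_value_mult)

lemmas has_value_intros =
  has_value_1 has_value_qvar has_value_add has_value_diff has_value_uminus has_value_mult has_value_divide has_value_power

lemma vanishes_mult:
  assumes "vanishes z e r" "vanishes z f s" shows "vanishes z (e + f) (r * s)"
proof -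
  obtain N D N' D' where *: "r = to_fract N / to_fract D" "poly (cpoly D) z \<noteq> 0" "[:- z, 1:] ^ e dvd cpoly N"
    "s = to_fract N' / to_fract D'" "poly (cpoly D') z \<noteq> 0" "[:- z, 1:] ^ f dvd cpoly N'"
    using assms unfolding vanishes_def by auto
  then show ?thesis
    unfolding vanishes_def
    by (intro exI[of _ "N * N'"] exI[of _ "D * D'"]) (simp add: cpoly_mult power_add mult_dvd_mono)
qed

lemma vanishes_add:
  assumes "vanishes z e r" "vanishes z e s" shows "vanishes z e (r + s)"
proof -
  obtain N D N' D' where *: "r = to_fract N / to_fract D" "poly (cpoly D) z \<noteq> 0" "[:- z, 1:] ^ e dvd cpoly N"
    "s = to_fract N' / to_fract D'" "poly (cpoly D') z \<noteq> 0" "[:- z, 1:] ^ e dvd cpoly N'"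
    using assms unfolding vanishes_def by auto
  with cpoly_nonzero[of D z] cpoly_nonzero[of D' z] show ?thesis
    unfolding vanishes_def
    by (intro exI[of _ "N * D' + N' * D"] exI[of _ "D * D'"]) (simp add: cpoly_mult cpoly_add add_frac_eq)
qed

lemma vanishes_uminus: "vanishes z e r \<Longrightarrow> vanishes z e (- r)"
  using vanishes_mult[of z 0 "- 1" e r] has_value_imp_vanishes[OF has_value_uminus[OF has_value_1]] by simp

lemma vanishes_diff: "vanishes z e r \<Longrightarrow> vanishes z e s \<Longrightarrow> vanishes z e (r - s)"
  using vanishes_add[of z e r "- s"] vanishes_uminus by simp

lemma vanishes_zero [simp]: "vanishes z e 0"
  unfolding vanishes_def by (intro exI[of _ 0] exI[of _ 1]) simp

lemma vanishes_sum: "(\<And>i. i \<in> A \<Longrightarrow> vanishes z e (f i)) \<Longrightarrow> vanishes z e (sum f A)"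
  by (induction A rule: infinite_finite_induct) (auto intro: vanishes_add)

lemma vanishes_times: "vanishes z 0 r \<Longrightarrow> vanishes z e s \<Longrightarrow> vanishes z e (r * s)"
  using vanishes_mult[of z 0 r e s] by simp

lemma vanishes_power: "vanishes z (Suc 0) r \<Longrightarrow> vanishes z k (r ^ k)"
  by (induction k) (use vanishes_mult[of z "Suc 0" r] has_value_imp_vanishes[OF has_value_1] in auto)

lemma qvar_power: "qvar ^ i = to_fract (monom 1 i)"
  by (induction i) (simp_all add: qvar_def monom_Suc flip: to_fract_mult)

interpretation Q: generic_base qvar
proof
  show "qvar \<noteq> 0" by (simp add: qvar_def)
  show "qvar ^ i \<noteq> 1" if "i > 0" for i
  proof
    assume "qvar ^ i = 1"
    then have "monom 1 i = (1 :: int poly)"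
      unfolding qvar_power by (metis to_fract_1 to_fract_eq_iff)
    then have "degree (monom (1::int) i) = degree (1 :: int poly)" by simp
    then show False using that by (simp add: degree_monom_eq)
  qed
qed

section \<open>From orders of vanishing to divisibility in Z[q]\<close>

lemma vanishes_numerator:
  assumes "vanishes z e r" shows "[:- z, 1:] ^ e dvd cpoly (fst (quot_of_fract r))"
proof -
  obtain N D where *: "r = to_fract N / to_fract D" "poly (cpoly D) z \<noteq> 0" "[:- z, 1:] ^ e dvd cpoly N"
    using assms unfolding vanishes_def by auto
  obtain u v where uv: "quot_of_fract r = (u, v)" by force
  have v: "v \<noteq> 0" using snd_quot_of_fract_nonzero[of r] uv by simp
  have "r = to_fract u / to_fract v"
    using uv by (metis Fract_conv_to_fract Fract_quot_of_fract fst_conv snd_conv)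
  then have "to_fract (u * D) = to_fract (N * v)"
    using * v cpoly_nonzero[OF *(2)] by (simp add: divide_simps)
  then have "cpoly u * cpoly D = cpoly N * cpoly v"
    by (metis to_fract_eq_iff cpoly_mult)
  then have "[:- z, 1:] ^ e dvd cpoly u * cpoly D" using *(3) by simp
  \<comment> \<open>The denominator \<open>D\<close> is nonzero at \<open>z\<close>, so the whole
    power of the linear factor must divide the reduced numerator \<open>u\<close>.\<close>
  moreover have "coprime [:- z, 1:] (cpoly D)"
    using *(2) by (intro prime_elem_imp_coprime prime_elem_linear_field_poly)
      (simp_all add: poly_eq_0_iff_dvd)
  ultimately show ?thesis using uv by (simp add: coprime_dvd_mult_left_iff)
qed

lemma prod_linear_powers_dvd:
  fixes p :: "complex poly"
  assumes "finite Z" "\<And>z. z \<in> Z \<Longrightarrow> [:- z, 1:] ^ e z dvd p"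
  shows "(\<Prod>z\<in>Z. [:- z, 1:] ^ e z) dvd p"
  using assms
proof (induction Z)
  case (insert z Z)
  have "coprime ([:- z, 1:] ^ e z) (\<Prod>w\<in>Z. [:- w, 1:] ^ e w)"
  proof (rule prod_coprime_right)
    fix w assume "w \<in> Z"
    then have "z \<noteq> w" using insert.hyps by auto
    then have "\<not> [:- z, 1:] dvd [:- w, 1:]" by (simp flip: poly_eq_0_iff_dvd)
    then have "coprime [:- z, 1:] [:- w, 1:]"
      by (intro prime_elem_imp_coprime prime_elem_linear_field_poly) simp_all
    then show "coprime ([:- z, 1:] ^ e z) ([:- w, 1:] ^ e w)" by simp
  qed
  then show ?case using insert by (auto intro: divides_mult)
qed simp

text \<open>Division by a monic polynomial stays in Z[q]. The remainder is divisible by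
  \<open>cpoly P\<close> over the complex numbers and has smaller degree, so it is zero.\<close>

lemma cpoly_dvd_imp_dvd:
  assumes "lead_coeff P = 1" "cpoly P dvd cpoly u" shows "P dvd u"
proof -
  have P0: "P \<noteq> 0" using assms by auto
  obtain S R where SR: "pseudo_divmod u P = (S, R)" by force
  have eq: "u = P * S + R" and R: "R = 0 \<or> degree R < degree P"
    using pseudo_divmod[OF P0 SR] assms(1) by auto
  have deg: "degree (cpoly p) = degree p" for p
    unfolding cpoly_def by (rule degree_map_poly) auto
  have "cpoly P dvd cpoly R"
    using assms(2) unfolding eq cpoly_add cpoly_mult by (simp add: dvd_add_right_iff)
  then have "cpoly R = 0"
    using R dvd_imp_degree_le[of "cpoly P" "cpoly R"] by (cases "cpoly R = 0") (auto simp: deg)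
  then have "R = 0" using of_int_poly_eq_iff[of R 0] by (simp add: cpoly_def)
  then show ?thesis using eq by simp
qed

lemma cpoly_qint: "cpoly (qint [:0, 1:] n) * [:-1, 1:] = monom 1 n - 1"
proof (induction n)
  case (Suc n)
  have "cpoly (qint [:0, 1:] (Suc n)) * [:-1, 1:] = cpoly (qint [:0, 1:] n) * [:-1, 1:] + cpoly ([:0, 1:] ^ n) * [:-1, 1:]"
    by (simp add: qint_def cpoly_add algebra_simps)
  also have "cpoly ([:0, 1:] ^ n) = monom 1 n"
    unfolding cpoly_power by (simp add: monom_altdef)
  finally show ?case unfolding Suc.IH by (simp add: monom_Suc algebra_simps)
qed (simp add: qint_def)

text \<open>The roots of [n] are the n-th roots of unity other than 1, all simple; the squared
  cyclotomic factor adds 2 to the multiplicity of the primitive ones. For \<open>n > 1\<close> these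
  are among the roots of [n], which gives multiplicities 3 and 1.\<close>

lemma ratfun_congI:
  assumes n: "n > 1"
    and simple: "\<And>z. z ^ n = 1 \<Longrightarrow> z \<noteq> 1 \<Longrightarrow> vanishes z 1 (A - B)"
    and triple: "\<And>z. z \<in> primitive_roots_of_unity n \<Longrightarrow> vanishes z 3 (A - B)"
  shows "ratfun_cong A B (qint [:0, 1:] n * cyclotomic n ^ 2)"
proof -
  define Z where "Z = {z::complex. z ^ n = 1 \<and> z \<noteq> 1}"
  define P where "P = primitive_roots_of_unity n"
  define u where "u = fst (quot_of_fract (A - B))"
  have fin: "finite Z" unfolding Z_def using n by (intro finite_subset[OF _ finite_roots_unity[of n]]) auto
  have PZ: "P \<subseteq> Z" unfolding P_def Z_def primitive_roots_of_unity_def using n by (auto intro: exI[of _ 1])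
  have "{z. z ^ n = 1} = insert 1 Z" "1 \<notin> Z" by (auto simp: Z_def)
  then have "cpoly (qint [:0, 1:] n) * [:-1, 1:] = (\<Prod>z\<in>Z. [:- z, 1:]) * [:-1, 1:]"
    using cpoly_qint[of n] prod_roots_of_unity[of n] n fin by (simp add: mult.commute)
  then have q: "cpoly (qint [:0, 1:] n) = (\<Prod>z\<in>Z. [:- z, 1:])"
    by (rule mult_right_cancel[THEN iffD1, rotated]) simp
  have c: "cpoly (cyclotomic n) = (\<Prod>z\<in>P. [:- z, 1:])"
    unfolding cpoly_def P_def using of_int_cyclotomic n by simp
  have eq: "cpoly (qint [:0, 1:] n * cyclotomic n ^ 2) = (\<Prod>z\<in>Z. [:- z, 1:] ^ (if z \<in> P then 3 else 1))"
  proof -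
    have "cpoly (qint [:0, 1:] n * cyclotomic n ^ 2) = (\<Prod>z\<in>Z. [:- z, 1:]) * (\<Prod>z\<in>P. [:- z, 1:] ^ 2)"
      by (simp add: cpoly_mult cpoly_power q c prod_power_distrib)
    also have "(\<Prod>z\<in>P. [:- z, 1:] ^ 2) = (\<Prod>z\<in>Z. if z \<in> P then [:- z, 1:] ^ 2 else 1)"
      using fin PZ by (simp add: prod.inter_restrict[symmetric] Int_absorb1)
    finally show ?thesis
      unfolding prod.distrib[symmetric] by (auto intro!: prod.cong simp: power2_eq_square power3_eq_cube)
  qed
  have "cpoly (qint [:0, 1:] n * cyclotomic n ^ 2) dvd cpoly u"
    unfolding eq u_def
  proof (rule prod_linear_powers_dvd[OF fin], rule vanishes_numerator)
    fix z assume "z \<in> Z"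
    then show "vanishes z (if z \<in> P then 3 else 1) (A - B)"
      using simple[of z] triple[of z] by (auto simp: Z_def P_def)
  qed
  moreover have "lead_coeff (qint [:0, 1:] n * cyclotomic n ^ 2) = 1"
  proof -
    have "complex_of_int (lead_coeff p) = lead_coeff (cpoly p)" for p
      unfolding cpoly_def by (simp add: coeff_map_poly degree_map_poly)
    from this[of "qint [:0, 1:] n * cyclotomic n ^ 2"] show ?thesis
      unfolding eq lead_coeff_prod by (simp add: lead_coeff_power)
  qed
  ultimately have "qint [:0, 1:] n * cyclotomic n ^ 2 dvd u" by (intro cpoly_dvd_imp_dvd)
  then show ?thesis by (simp add: ratfun_cong_def u_def)
qed

subsection \<open>Values of the summands at a primitive root of odd order\<close>

locale odd_root =
  fixes z :: complex and d m :: nat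
  assumes d: "d = 2 * m + 1" and m: "m > 0" and root: "z \<in> primitive_roots_of_unity d"
begin

lemma z_d: "z ^ d = 1" and z_nonzero [simp]: "z \<noteq> 0"
  using root d by (auto simp: primitive_roots_of_unity_def)

lemma power_mod: "z ^ (i mod d) = z ^ i"
proof -
  have "z ^ i = z ^ (d * (i div d) + i mod d)" by simp
  also have "\<dots> = z ^ (i mod d)" unfolding power_add power_mult z_d by simp
  finally show ?thesis ..
qed

lemma power_eq_1_iff: "z ^ i = 1 \<longleftrightarrow> d dvd i"
proof -
  have "i mod d < d" using d by simp
  then have "z ^ (i mod d) = 1 \<longleftrightarrow> i mod d = 0"
    using root by (auto simp: primitive_roots_of_unity_def)
  then show ?thesis by (simp add: power_mod dvd_eq_mod_eq_0)
qed

lemma power_neq_1: "0 < i \<Longrightarrow> i < d \<Longrightarrow> 1 - z ^ i \<noteq> 0"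
  using power_eq_1_iff[of i] by (auto dest: dvd_imp_le)

text \<open>2 is invertible modulo the odd order d.\<close>

lemma even_power_neq_1: "0 < i \<Longrightarrow> i < d \<Longrightarrow> 1 - z ^ (2 * i) \<noteq> 0"
proof -
  assume "0 < i" "i < d"
  moreover have "coprime d 2" using d by simp
  ultimately show ?thesis
    using power_eq_1_iff[of "2 * i"] by (auto simp: coprime_dvd_mult_right_iff dest: dvd_imp_le)
qed

text \<open>A power equal to -1 would have d-th power -1, as d is odd.\<close>

lemma plus_power_neq_0: "1 + z ^ i \<noteq> 0"
proof
  assume "1 + z ^ i = 0"
  then have *: "z ^ i = - 1" by (simp add: add_eq_0_iff)
  have "odd d" using d by simp
  then have "z ^ (i * d) = - 1" unfolding power_mult * by simp
  moreover have "z ^ (i * d) = 1" by (simp add: power_eq_1_iff)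
  ultimately show False by simp
qed

section \<open>Values at z and their reflection k -> m - k\<close>

definition B :: "nat \<Rightarrow> complex" where
  "B k = (\<Prod>i<k. (1 - z ^ (2 * i + 1)) / (1 - z ^ (2 * i + 2)))"

definition c :: "nat \<Rightarrow> complex" where
  "c k = (-1) ^ k * (1 - z ^ (4 * k + 1)) * B k ^ 5 * z ^ (k ^ 2 + k)"

definition \<phi> :: "nat \<Rightarrow> complex" where "\<phi> i = z ^ i / (1 - z ^ i) ^ 2"

definition E :: "nat \<Rightarrow> complex" where
  "E k = (\<Sum>j<k. \<phi> (2 * j + 2) - \<phi> (2 * j + 1))"

lemma z_reflect: "i \<le> d \<Longrightarrow> z ^ (d - i) = 1 / z ^ i"
  using z_d power_add[of z i "d - i"] by (simp add: field_simps)

lemma one_minus_reflect: "i \<le> d \<Longrightarrow> 1 - z ^ (d - i) = - (1 - z ^ i) / z ^ i"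
  by (simp add: z_reflect field_simps)

text \<open>The function y/(1-y)^2 is invariant under y -> 1/y.\<close>

lemma \<phi>_reflect:
  assumes "i \<le> d" shows "\<phi> (d - i) = \<phi> i"
  unfolding \<phi>_def one_minus_reflect[OF assms] z_reflect[OF assms]
  by (simp add: power_divide power2_eq_square divide_simps) (simp add: algebra_simps)

lemma B_Suc: "B (Suc k) = B k * ((1 - z ^ (2 * k + 1)) / (1 - z ^ (2 * k + 2)))"
  by (simp add: B_def)

text \<open>As d is odd, i -> d - i exchanges odd and even exponents. The ratio removed from
  \<open>B\<close> on passing from m - k to m - k - 1 is therefore, up to a power of z, the inverse
  of the ratio added on passing from k to k + 1.\<close>

lemma B_reflect:
  assumes "k \<le> m" shows "B (m - k) = B m * B k * z ^ k"
  using assms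
proof (induction k)
  case 0
  then show ?case by (simp add: B_def)
next
  case (Suc k)
  define r where "r = m - Suc k"
  have r: "m - k = Suc r" "m = k + Suc r" using Suc.prems by (auto simp: r_def)
  have "2 * r + 1 = d - (2 * k + 2)" "2 * r + 2 = d - (2 * k + 1)" using r d by auto
  moreover have "2 * k + 2 \<le> d" "2 * k + 1 \<le> d" using r d by auto
  ultimately have *: "1 - z ^ (2 * r + 1) = - (1 - z ^ (2 * k + 2)) / z ^ (2 * k + 2)"
     "1 - z ^ (2 * r + 2) = - (1 - z ^ (2 * k + 1)) / z ^ (2 * k + 1)"
    using one_minus_reflect by metis+
  have nz: "1 - z ^ (2 * k + 1) \<noteq> 0" "1 - z ^ (2 * k + 2) \<noteq> 0"
    by (rule power_neq_1; use r d in simp)+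
  have "B (Suc r) = B m * B k * z ^ k" using Suc r by simp
  then have "B r * ((- (1 - z ^ (2 * k + 2)) / z ^ (2 * k + 2)) / (- (1 - z ^ (2 * k + 1)) / z ^ (2 * k + 1))) = B m * B k * z ^ k"
    unfolding B_Suc * .
  moreover define u v Z where "u = 1 - z ^ (2 * k + 1)" and "v = 1 - z ^ (2 * k + 2)" and "Z = z ^ (2 * k + 1)"
  moreover have "z ^ (2 * k + 2) = Z * z" by (simp add: Z_def)
  ultimately have "B r * ((- v / (Z * z)) / (- u / Z)) = B m * B k * z ^ k" by metis
  moreover have "(- v / (Z * z)) / (- u / Z) = v / (u * z)" by (simp add: Z_def del: power_Suc)
  ultimately have "B r * (v / (u * z)) = B m * B k * z ^ k" by (simp only:)
  then have "B r = B m * (B k * (u / v)) * (z ^ k * z)"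
    using nz unfolding u_def[symmetric] v_def[symmetric] by (simp add: field_simps)
  then show ?case unfolding r_def[symmetric] B_Suc u_def v_def by simp
qed

text \<open>Read backwards, the numerator of \<open>B m\<close> is its denominator up to signs and
  powers of z.\<close>

lemma B_m: "B m * z ^ (m * (m + 1)) = (-1) ^ m"
proof -
  have e: "1 - z ^ (2 * i + 2) \<noteq> 0" if "i < m" for i
    using that d by (intro power_neq_1) auto
  have "(\<Prod>i<m. 1 - z ^ (2 * i + 1)) = (\<Prod>i<m. 1 - z ^ (2 * (m - Suc i) + 1))"
    by (rule prod.nat_diff_reindex[symmetric])
  also have "\<dots> = (\<Prod>i<m. - (1 - z ^ (2 * i + 2)) / z ^ (2 * i + 2))"
  proof (rule prod.cong[OF refl])
    fix i assume "i \<in> {..<m}"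
    then have "2 * (m - Suc i) + 1 = d - (2 * i + 2)" "2 * i + 2 \<le> d" using d by auto
    then show "1 - z ^ (2 * (m - Suc i) + 1) = - (1 - z ^ (2 * i + 2)) / z ^ (2 * i + 2)"
      using one_minus_reflect by metis
  qed
  also have "\<dots> = (-1) ^ m * (\<Prod>i<m. 1 - z ^ (2 * i + 2)) / (\<Prod>i<m. z ^ (2 * i + 2))"
  proof -
    have "(\<Prod>i<m. - (1 - z ^ (2 * i + 2)) / z ^ (2 * i + 2)) = (\<Prod>i<m. (-1) * (1 - z ^ (2 * i + 2)) / z ^ (2 * i + 2))"
      by simp
    then show ?thesis unfolding prod_dividef prod.distrib by simp
  qed
  also have "(\<Prod>i<l. z ^ (2 * i + 2)) = z ^ (l * (l + 1))" for l
  proof (induction l)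
    case (Suc l)
    have "Suc l * (Suc l + 1) = l * (l + 1) + (2 * l + 2)" by simp
    then show ?case unfolding prod.lessThan_Suc Suc by (simp only: power_add)
  qed simp
  finally have "(\<Prod>i<m. 1 - z ^ (2 * i + 1)) = (-1) ^ m * (\<Prod>i<m. 1 - z ^ (2 * i + 2)) / z ^ (m * (m + 1))" .
  then show ?thesis unfolding B_def prod_dividef using e by (simp del: power_Suc)
qed

text \<open>The signs from (-1)^(m-k) and \<open>B m ^ 5\<close> combine to (-1)^k. The minus that
  remains comes from 1 - z^(4k+1), since 4k+1 and 4(m-k)+1 add up to 2d.\<close>

lemma c_reflect:
  assumes k: "k \<le> m" shows "c (m - k) = - c k"
proof -
  obtain r where r: "m = k + r" using k less_eqE by blast
  have Bm: "B m ^ 5 = (-1) ^ m / z ^ (5 * (m * (m + 1)))"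
  proof -
    have "(B m * z ^ (m * (m + 1))) ^ 5 = ((-1) ^ m) ^ 5" unfolding B_m ..
    moreover have "((-1) ^ m) ^ 5 = (-1 :: complex) ^ m" by (simp add: minus_one_power_iff)
    ultimately show ?thesis by (simp add: power_mult_distrib field_simps flip: power_mult)
  qed
  have s: "(-1) ^ (m - k) * (-1) ^ m = (-1 :: complex) ^ k"
    using k by (simp add: minus_one_power_iff)
  have "4 * (m - k) + 1 + (4 * k + 1) = d + d" using k d by simp
  then have "z ^ (4 * (m - k) + 1) * z ^ (4 * k + 1) = 1" 
    by (metis power_add z_d mult_1)
  then have f: "1 - z ^ (4 * (m - k) + 1) = - (1 - z ^ (4 * k + 1)) / z ^ (4 * k + 1)"
    by (simp add: field_simps)
  \<comment> \<open>The exponents of z on the two sides differ by a multiple of d.\<close>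
  have "k ^ 2 + k + 5 * (m * (m + 1)) + (4 * k + 1) = 5 * k + ((m - k) ^ 2 + (m - k)) + d * (d + k)"
    unfolding d r by (simp add: power2_eq_square algebra_simps)
  then have "z ^ (k ^ 2 + k) * z ^ (5 * (m * (m + 1))) * z ^ (4 * k + 1) = z ^ (5 * k) * z ^ ((m - k) ^ 2 + (m - k)) * z ^ (d * (d + k))"
    by (metis power_add)
  moreover have "z ^ (d * (d + k)) = 1" by (simp only: power_mult z_d power_one)
  ultimately have g: "z ^ (5 * k) * z ^ ((m - k) ^ 2 + (m - k)) / (z ^ (5 * (m * (m + 1))) * z ^ (4 * k + 1)) = z ^ (k ^ 2 + k)"
    by (simp add: divide_simps mult.assoc del: power_Suc)
  have "c (m - k) = (-1) ^ (m - k) * (- (1 - z ^ (4 * k + 1)) / z ^ (4 * k + 1)) * (B m ^ 5 * B k ^ 5 * z ^ (5 * k)) * z ^ ((m - k) ^ 2 + (m - k))"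
    unfolding c_def B_reflect[OF k] f by (simp add: power_mult_distrib mult.commute[of k] flip: power_mult)
  also have "\<dots> = - (((-1) ^ (m - k) * (-1) ^ m) * (1 - z ^ (4 * k + 1)) * B k ^ 5 * (z ^ (5 * k) * z ^ ((m - k) ^ 2 + (m - k)) / (z ^ (5 * (m * (m + 1))) * z ^ (4 * k + 1))))"
  proof -
    have "x * (- u / w) * (y / v * t * s) * r = - (x * y * u * t * (s * r / (v * w)))" for x u w y v t s r :: complex
      by (simp add: mult_ac)
    then show ?thesis unfolding Bm .
  qed
  also have "\<dots> = - c k" unfolding s g c_def ..
  finally show ?thesis .
qed

text \<open>The case k = 0 says that \<open>E m\<close> is zero: i -> d - i maps the odd exponents
  1, ..., d-2 onto the even exponents 2, ..., d-1 and preserves \<open>\<phi>\<close>.\<close>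

lemma E_reflect:
  assumes "k \<le> m" shows "E (m - k) = E k"
  using assms
proof (induction k)
  case 0
  have "(\<Sum>j<m. \<phi> (2 * j + 1)) = (\<Sum>j<m. \<phi> (2 * (m - Suc j) + 1))"
    by (rule sum.nat_diff_reindex[symmetric])
  also have "\<dots> = (\<Sum>j<m. \<phi> (2 * j + 2))"
  proof (rule sum.cong[OF refl])
    fix i assume "i \<in> {..<m}"
    then have "2 * (m - Suc i) + 1 = d - (2 * i + 2)" "2 * i + 2 \<le> d" using d by auto
    then show "\<phi> (2 * (m - Suc i) + 1) = \<phi> (2 * i + 2)"
      using \<phi>_reflect by metis
  qed
  finally show ?case by (simp add: E_def sum_subtractf)
next
  case (Suc k)
  define r where "r = m - Suc k"
  have r: "m - k = Suc r" "m = k + Suc r" using Suc.prems by (auto simp: r_def)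
  have "2 * r + 1 = d - (2 * k + 2)" "2 * r + 2 = d - (2 * k + 1)" using r d by auto
  moreover have "2 * k + 2 \<le> d" "2 * k + 1 \<le> d" using r d by auto
  ultimately have "\<phi> (2 * r + 1) = \<phi> (2 * k + 2)" "\<phi> (2 * r + 2) = \<phi> (2 * k + 1)"
    using \<phi>_reflect by metis+
  then show ?case using Suc unfolding r_def[symmetric] r(1) by (simp add: E_def algebra_simps)
qed

lemma antisymmetric_sum:
  fixes f :: "nat \<Rightarrow> complex"
  assumes "\<And>k. k \<le> m \<Longrightarrow> f (m - k) = - f k" shows "(\<Sum>k\<le>m. f k) = 0"
proof -
  have "(\<Sum>k\<le>m. f k) = (\<Sum>k\<le>m. f (m - k))"
    by (rule sum.reindex_bij_witness[of _ "\<lambda>k. m - k" "\<lambda>k. m - k"]) auto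
  also have "\<dots> = - (\<Sum>k\<le>m. f k)" using assms by (simp add: sum_negf)
  finally show ?thesis by simp
qed

lemma c_sum: "(\<Sum>k\<le>m. c k) = 0" and c_E_sum: "(\<Sum>k\<le>m. c k * E k) = 0"
  by (rule antisymmetric_sum; simp add: c_reflect E_reflect)+

lemma B_eq_0:
  assumes "m < k" shows "B k = 0"
proof -
  have "2 * m + 1 = d" by (simp add: d)
  then have "1 - z ^ (2 * m + 1) = 0" using z_d by simp
  then show ?thesis unfolding B_def using assms by (intro prod_zero bexI[of _ m]) (auto simp del: power_Suc)
qed

lemma c_sum_block: "(\<Sum>k<d. c k) = 0"
proof -
  have "(\<Sum>k<d. c k) = (\<Sum>k\<le>m. c k)"
    by (rule sum.mono_neutral_right) (auto simp: d c_def B_eq_0)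
  then show ?thesis by (simp add: c_sum)
qed

end

subsection \<open>Vanishing of the sums to first order\<close>

definition bq :: "nat \<Rightarrow> ratfun" where "bq k = Q.odds k / Q.evens k"

definition cq :: "nat \<Rightarrow> ratfun" where
  "cq k = (-1) ^ k * (1 - qvar ^ (4 * k + 1)) * bq k ^ 5 * qvar ^ (k ^ 2 + k)"

lemma bq_0 [simp]: "bq 0 = 1" by (simp add: bq_def)

lemma bq_Suc: "bq (Suc k) = bq k * ((1 - qvar ^ (2 * k + 1)) / (1 - qvar ^ (2 * k + 2)))"
  by (simp add: bq_def Q.odds_Suc Q.evens_Suc)

lemma gauss_binomial:
  "\<exists>P. qpoch qvar qvar (n + k) = to_fract P * qpoch qvar qvar n * qpoch qvar qvar k"
proof (induction "n + k" arbitrary: n k)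
  case 0
  then show ?case by (auto intro: exI[of _ 1])
next
  case (Suc N)
  consider "n = 0" | "k = 0" | n' k' where "n = Suc n'" "k = Suc k'" by (cases n; cases k) auto
  then show ?case
  proof cases
    case 3
    obtain P where P: "qpoch qvar qvar (n' + k) = to_fract P * qpoch qvar qvar n' * qpoch qvar qvar k"
      using Suc.hyps(1)[of n' k] Suc.hyps(2) 3 by auto
    obtain P' where P': "qpoch qvar qvar (n + k') = to_fract P' * qpoch qvar qvar n * qpoch qvar qvar k'"
      using Suc.hyps(1)[of n k'] Suc.hyps(2) 3 by auto
    have e: "n + k = Suc N" "N = n' + k" "N = n + k'" using Suc.hyps(2) 3 by auto
    \<comment> \<open>The q-Pascal rule, in the form 1 - q^(n+k) = (1 - q^n) + q^n (1 -
      q^k).\<close>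
    have u: "1 - qvar * qvar ^ N = (1 - qvar * qvar ^ n') + qvar ^ n * (1 - qvar * qvar ^ k')"
      using e 3 by (simp add: algebra_simps power_add)
    have "qpoch qvar qvar (n + k) =
       qpoch qvar qvar N * (1 - qvar * qvar ^ n') + qvar ^ n * (qpoch qvar qvar N * (1 - qvar * qvar ^ k'))"
      unfolding e(1) qpoch_Suc u by (simp add: algebra_simps)
    also have "qpoch qvar qvar N * (1 - qvar * qvar ^ n') = to_fract P * qpoch qvar qvar n * qpoch qvar qvar k"
      unfolding e(2) P 3(1) qpoch_Suc by (simp add: mult_ac)
    also have "qpoch qvar qvar N * (1 - qvar * qvar ^ k') = to_fract P' * qpoch qvar qvar n * qpoch qvar qvar k"
      unfolding e(3) P' 3(2) qpoch_Suc by (simp add: mult_ac)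
    finally show ?thesis
      by (intro exI[of _ "P + monom 1 n * P'"]) (simp add: algebra_simps qvar_power)
  qed (auto intro: exI[of _ 1])
qed

text \<open>Extending by \<open>Q.evens k\<close> turns the numerator into (q;q)_{2k}. Since
  (q^2;q^2)_k is (q;q)_k times the product of the 1 + q^j, the quotient is a central Gauss binomial
  over the square of that product.\<close>

lemma bq_regular:
  assumes "\<And>i. 1 + z ^ i \<noteq> 0" shows "vanishes z 0 (bq k)"
proof -
  define w where "w = (\<Prod>j<k. 1 + qvar ^ (j + 1))"
  have 1: "Q.odds k * Q.evens k = qpoch qvar qvar (k + k)"
    unfolding mult_2[symmetric] by (induction k) (simp_all add: Q.odds_Suc Q.evens_Suc qpoch_Suc mult_ac)
  have 2: "Q.evens k = qpoch qvar qvar k * w" unfolding w_def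
    by (induction k) (simp_all add: Q.evens_Suc qpoch_Suc algebra_simps mult_2_right power_add)
  obtain P where P: "qpoch qvar qvar (k + k) = to_fract P * qpoch qvar qvar k * qpoch qvar qvar k"
    using gauss_binomial by blast
  have nz: "qpoch qvar qvar k \<noteq> 0" "w \<noteq> 0" using Q.evens_nonzero[of k] unfolding 2 by auto
  have "bq k = (Q.odds k * Q.evens k) / Q.evens k ^ 2"
    by (simp add: bq_def power2_eq_square)
  also have "\<dots> = to_fract P / w ^ 2"
    unfolding 1 P unfolding 2 using nz by (simp add: power2_eq_square)
  finally have "bq k = to_fract P / w ^ 2" .
  moreover have "has_value z w (\<Prod>j<k. 1 + z ^ (j + 1))" unfolding w_def
    by (intro has_value_prod has_value_intros)
  then have "has_value z (to_fract P / w ^ 2) (poly (cpoly P) z / (\<Prod>j<k. 1 + z ^ (j + 1)) ^ 2)"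
    using assms by (intro has_value_intros has_value_to_fract) (simp_all del: power_Suc)
  ultimately show ?thesis using has_value_imp_vanishes by metis
qed

lemma sum_lessThan_add:
  fixes f :: "nat \<Rightarrow> 'a::comm_monoid_add"
  shows "(\<Sum>k<m + n. f k) = (\<Sum>k<m. f k) + (\<Sum>k<n. f (m + k))"
  by (induction n) (simp_all add: add.assoc)

context odd_root
begin

lemma power_shift: "z ^ (l * d + i) = z ^ i"
  by (simp add: power_add power_mult mult.commute[of l] z_d)

text \<open>The factors beyond index l d have at z the same values as those of the first block,
  because exponents count modulo d. The bound \<open>k < d\<close> keeps their denominators away
  from zero.\<close>

lemma bq_block:
  assumes "has_value z (bq (l * d)) \<beta>" "k < d"
  shows "has_value z (bq (l * d + k)) (\<beta> * B k)"
  using assms(2)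
proof (induction k)
  case 0
  then show ?case using assms(1) by (simp add: B_def)
next
  case (Suc k)
  have "2 * (l * d + k) + 1 = 2 * l * d + (2 * k + 1)" "2 * (l * d + k) + 2 = 2 * l * d + (2 * k + 2)" by simp_all
  then have *: "z ^ (2 * (l * d + k) + 1) = z ^ (2 * k + 1)" "z ^ (2 * (l * d + k) + 2) = z ^ (2 * k + 2)"
    by (metis power_shift)+
  have "1 - z ^ (2 * k + 2) \<noteq> 0" using even_power_neq_1[of "Suc k"] Suc.prems by simp
  then have "has_value z ((1 - qvar ^ (2 * (l * d + k) + 1)) / (1 - qvar ^ (2 * (l * d + k) + 2)))
      ((1 - z ^ (2 * k + 1)) / (1 - z ^ (2 * k + 2)))"
    unfolding *[symmetric] by (intro has_value_intros)
  then show ?case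
    unfolding add_Suc_right bq_Suc B_Suc mult.assoc[symmetric]
    using Suc by (simp only: has_value_mult Suc_lessD mult.assoc[symmetric])
qed

lemma has_value_bq: "k < d \<Longrightarrow> has_value z (bq k) (B k)"
  using bq_block[of 0 1 k] by simp

lemma bq_regular_root: "vanishes z 0 (bq k)"
  by (rule bq_regular) (rule plus_power_neq_0)

lemma cq_block:
  assumes "has_value z (bq (l * d)) \<beta>" "k < d"
  shows "has_value z (cq (l * d + k)) ((-1) ^ l * \<beta> ^ 5 * c k)"
proof -
  have "has_value z (cq (l * d + k)) ((-1) ^ (l * d + k) * (1 - z ^ (4 * (l * d + k) + 1)) * (\<beta> * B k) ^ 5
      * z ^ ((l * d + k) ^ 2 + (l * d + k)))"
    unfolding cq_def by (intro has_value_intros bq_block assms)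
  moreover have "(-1) ^ (l * d + k) = (-1 :: complex) ^ l * (-1) ^ k"
    using d by (simp add: minus_one_power_iff)
  moreover have "4 * (l * d + k) + 1 = 4 * l * d + (4 * k + 1)"
    "(l * d + k) ^ 2 + (l * d + k) = (l * d * l + 2 * l * k + l) * d + (k ^ 2 + k)"
    by (simp_all add: power2_eq_square algebra_simps)
  then have "z ^ (4 * (l * d + k) + 1) = z ^ (4 * k + 1)" "z ^ ((l * d + k) ^ 2 + (l * d + k)) = z ^ (k ^ 2 + k)"
    by (metis power_shift)+
  ultimately show ?thesis by (simp add: c_def power_mult_distrib mult_ac del: power_Suc)
qed

text \<open>Regularity provides some value \<open>\<beta>\<close> at the start of the block. It is a
  common factor, so the block sum is a multiple of the sum of \<open>c\<close>.\<close>

lemma cq_partial_block: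
  assumes "h \<le> d" "(\<Sum>k<h. c k) = 0"
  shows "has_value z (\<Sum>k<h. cq (l * d + k)) 0"
proof -
  obtain \<beta> where \<beta>: "has_value z (bq (l * d)) \<beta>"
    using bq_regular_root by (auto simp: vanishes_0_iff)
  have "has_value z (\<Sum>k<h. cq (l * d + k)) (\<Sum>k<h. (-1) ^ l * \<beta> ^ 5 * c k)"
    using assms(1) by (intro has_value_sum cq_block \<beta>) auto
  then show ?thesis using assms(2) by (simp flip: sum_distrib_left)
qed

lemma cq_blocks: "has_value z (\<Sum>k<l * d. cq k) 0"
proof (induction l)
  case (Suc l)
  have "(\<Sum>k<Suc l * d. cq k) = (\<Sum>k<l * d. cq k) + (\<Sum>k<d. cq (l * d + k))"
    by (simp add: add.commute[of d] sum_lessThan_add)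
  then show ?case
    using has_value_add[OF Suc cq_partial_block[OF order_refl c_sum_block]] by simp
qed simp

text \<open>If n = (2l+1) d, then (n-1)/2 = l d + m: the half range consists of l full blocks and
  the first half of another, and the sum of \<open>c\<close> is zero over each.\<close>

lemma cq_half_blocks: "has_value z (\<Sum>k\<le>l * d + m. cq k) 0"
proof -
  have "(\<Sum>k\<le>l * d + m. cq k) = (\<Sum>k<l * d. cq k) + (\<Sum>k<Suc m. cq (l * d + k))"
    using sum_lessThan_add[of cq "l * d" "Suc m"] by (simp add: lessThan_Suc_atMost[symmetric])
  moreover have "(\<Sum>k<Suc m. c k) = 0" using c_sum by (simp add: lessThan_Suc_atMost)
  ultimately show ?thesis
    using has_value_add[OF cq_blocks cq_partial_block[of "Suc m"]] m d by simp
qed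

end

subsection \<open>The congruence to third order\<close>

lemma has_value_nonzero: "has_value z r c \<Longrightarrow> c \<noteq> 0 \<Longrightarrow> r \<noteq> 0"
  unfolding has_value_def by auto

lemma vanishes_divide:
  assumes "vanishes z e r" "has_value z u c" "c \<noteq> 0" shows "vanishes z e (r / u)"
  using vanishes_times[OF has_value_imp_vanishes[OF has_value_inverse[OF assms(2,3)]] assms(1)]
  by (simp add: divide_inverse mult.commute)

text \<open>Factors symmetric under x -> 1/x involve x only through s = (1-x)^2/x, and
  linearly.\<close>

lemma symmetric_factor:
  fixes x y :: "'a::field"
  assumes "x \<noteq> 0"
  shows "(1 - x * y) * (1 - y / x) = (1 - y) ^ 2 - y * ((1 - x) ^ 2 / x)"
  using assms by (simp add: field_simps power2_eq_square)

text \<open>The derivative at \<open>s = 0\<close> of the logarithm of \<open>Q.quot_prod x k\<close>, as a function of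
  \<open>s = (1 - x)\<^sup>2 / x\<close>.\<close>

definition correction :: "nat \<Rightarrow> ratfun" where
  "correction k = (\<Sum>j<k. qvar ^ (2 * j + 2) / (1 - qvar ^ (2 * j + 2)) ^ 2 - qvar ^ (2 * j + 1) / (1 - qvar ^ (2 * j + 1)) ^ 2)"

context odd_root
begin

definition s :: ratfun where "s = (1 - qvar ^ d) ^ 2 / qvar ^ d"

lemma vanishes_1_minus: "vanishes z 1 (1 - qvar ^ d)"
proof -
  have "has_value z (1 - qvar ^ d) (1 - z ^ d)" by (intro has_value_intros)
  then show ?thesis by (simp add: vanishes_1_iff z_d)
qed

lemma vanishes_s: "vanishes z 2 s"
proof -
  have "has_value z (qvar ^ d) (z ^ d)" by (intro has_value_intros)
  then show ?thesis unfolding s_def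
    using vanishes_power[of z "1 - qvar ^ d" 2] vanishes_1_minus vanishes_divide by (simp add: z_d)
qed

text \<open>Terms quadratic in \<open>s\<close> have order at least 4 and are negligible.\<close>

lemma vanishes_s_times: "vanishes z 0 r \<Longrightarrow> vanishes z 3 (s * s * r)"
  using vanishes_times[OF _ vanishes_mult[OF vanishes_s vanishes_s]] vanishes_mono[of z 4 _ 3]
  by (simp add: mult.commute)

lemma has_value_phi:
  assumes "0 < i" "i < d" shows "has_value z (qvar ^ i / (1 - qvar ^ i) ^ 2) (\<phi> i)"
  unfolding \<phi>_def using power_neq_1[OF assms] by (intro has_value_intros) simp

lemma has_value_correction:
  assumes "k \<le> m" shows "has_value z (correction k) (E k)"
  unfolding correction_def E_def using assms d by (intro has_value_sum has_value_diff has_value_phi) auto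

text \<open>Expansion to first order in \<open>s\<close>. By \<open>symmetric_factor\<close> each
  new factor is \<open>\<beta> ^ 2\<close> times (1 - P s)/(1 - R s), and \<open>correction\<close>
  accumulates the differences R - P.\<close>

lemma quot_prod_cong:
  assumes "k \<le> m"
  shows "vanishes z 3 (Q.quot_prod (qvar ^ d) k - bq k ^ 2 * (1 + s * correction k))"
  using assms
proof (induction k)
  case 0
  show ?case by (simp add: Q.quot_prod_def correction_def)
next
  case (Suc k)
  define x where "x = qvar ^ d"
  define y where "y = qvar ^ (2 * k + 1)"
  define w where "w = qvar ^ (2 * k + 2)"
  define \<beta> where "\<beta> = (1 - y) / (1 - w)"
  define P where "P = y / (1 - y) ^ 2"
  define R where "R = w / (1 - w) ^ 2"
  define \<rho> where "\<rho> = (1 - x * y) * (1 - y / x) / ((1 - x * w) * (1 - w / x))"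
  have x: "x \<noteq> 0" by (simp add: x_def)
  have sx: "s = (1 - x) ^ 2 / x" by (simp add: s_def x_def)
  have ny: "1 - y \<noteq> 0" "1 - w \<noteq> 0" unfolding y_def w_def by (rule Q.one_minus_q_power, simp)+
  have hP: "has_value z P (\<phi> (2 * k + 1))" unfolding P_def y_def
    using Suc.prems d by (intro has_value_phi) auto
  have hR: "has_value z R (\<phi> (2 * k + 2))" unfolding R_def w_def
    using Suc.prems d by (intro has_value_phi) auto
  have h\<beta>: "has_value z \<beta> ((1 - z ^ (2 * k + 1)) / (1 - z ^ (2 * k + 2)))"
    unfolding \<beta>_def y_def w_def using Suc.prems d by (intro has_value_intros power_neq_1) auto
  have hs: "has_value z s 0"
    using vanishes_mono[OF vanishes_s, of 1] by (simp add: vanishes_1_iff)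
  have hb: "has_value z (bq k) (B k)" using Suc.prems d by (intro has_value_bq) auto
  have he: "has_value z (correction k) (E k)" using Suc.prems by (intro has_value_correction) auto
  have hRs: "has_value z (1 - R * s) (1 - \<phi> (2 * k + 2) * 0)"
    by (intro has_value_intros hR hs)
  have nR: "1 - R * s \<noteq> 0" by (rule has_value_nonzero[OF hRs]) simp
  have \<rho>: "\<rho> = \<beta> ^ 2 * ((1 - P * s) / (1 - R * s))"
  proof -
    have "(1 - x * y) * (1 - y / x) = (1 - y) ^ 2 * (1 - P * s)"
      "(1 - x * w) * (1 - w / x) = (1 - w) ^ 2 * (1 - R * s)"
      unfolding symmetric_factor[OF x] sx P_def R_def using ny by (simp_all add: right_diff_distrib)
    then show ?thesis by (simp add: \<rho>_def \<beta>_def power_divide)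
  qed
  \<comment> \<open>The geometric expansion with its exact remainder, which is regular because 1 - R
    s has value 1 at z.\<close>
  have "(1 - P * s) / (1 - R * s) - (1 + s * (R - P)) = s * s * (R * (R - P) / (1 - R * s))"
  proof -
    have "(1 - P * s) - (1 + s * (R - P)) * (1 - R * s) = s * s * (R * (R - P))" by algebra
    then show ?thesis using nR by (simp add: divide_simps)
  qed
  then have "\<rho> - \<beta> ^ 2 * (1 + s * (R - P)) = s * s * (\<beta> ^ 2 * (R * (R - P) / (1 - R * s)))"
    unfolding \<rho> right_diff_distrib[symmetric] by (simp add: mult_ac)
  moreover have "has_value z (\<beta> ^ 2 * (R * (R - P) / (1 - R * s)))
     (((1 - z ^ (2 * k + 1)) / (1 - z ^ (2 * k + 2))) ^ 2 * (\<phi> (2 * k + 2) * (\<phi> (2 * k + 2) - \<phi> (2 * k + 1)) / (1 - \<phi> (2 * k + 2) * 0)))"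
    by (intro has_value_intros h\<beta> hR hP hRs hs) simp
  ultimately have 1: "vanishes z 3 (\<rho> - \<beta> ^ 2 * (1 + s * (R - P)))"
    using vanishes_s_times has_value_imp_vanishes by metis
  have h\<rho>: "vanishes z 0 \<rho>" unfolding \<rho>
    by (rule has_value_imp_vanishes, (rule has_value_intros h\<beta> hP hs hRs)+) simp
  have hb2: "vanishes z 0 (bq k ^ 2 * (1 + s * correction k))"
    by (rule has_value_imp_vanishes, (rule has_value_intros hb hs he)+)
  have h3: "vanishes z 0 (bq k ^ 2 * \<beta> ^ 2 * correction k * (R - P))"
    by (rule has_value_imp_vanishes, (rule has_value_intros hb h\<beta> he hR hP)+)
  define W where "W = Q.quot_prod x k"
  have "Q.quot_prod x (Suc k) = W * \<rho>"
    by (simp add: Q.quot_prod_def \<rho>_def y_def w_def W_def)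
  moreover have "bq (Suc k) = bq k * \<beta>" by (simp add: bq_Suc \<beta>_def y_def w_def)
  moreover have "correction (Suc k) = correction k + (R - P)" by (simp add: correction_def R_def P_def y_def w_def)
  \<comment> \<open>The error splits into the inherited one, that of the new factor, and the cross
    term of order \<open>s\<close> squared.\<close>
  moreover have "W * \<rho> - (bq k * \<beta>) ^ 2 * (1 + s * (correction k + (R - P))) =
     \<rho> * (W - bq k ^ 2 * (1 + s * correction k)) + (bq k ^ 2 * (1 + s * correction k)) * (\<rho> - \<beta> ^ 2 * (1 + s * (R - P)))
     + s * s * (bq k ^ 2 * \<beta> ^ 2 * correction k * (R - P))"
    by algebra
  moreover have "vanishes z 3 (W - bq k ^ 2 * (1 + s * correction k))"
    using Suc.IH Suc.prems by (simp add: W_def x_def)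
  note vanishes_add[OF vanishes_add[OF vanishes_times[OF h\<rho> this] vanishes_times[OF hb2 1]] vanishes_s_times[OF h3]]
  ultimately show ?case unfolding x_def by (simp only:)
qed

text \<open>Here the expansion stops at order 0 in \<open>s\<close>, leaving an error of order 2;
  \<open>half_sum_cong\<close> multiplies it by 1 - q^d.\<close>

lemma num_prod_cong:
  "vanishes z 2 (Q.num_prod (qvar ^ d) k - Q.odds k ^ 2) \<and> vanishes z 0 (Q.num_prod (qvar ^ d) k) \<and> vanishes z 0 (Q.odds k)"
proof (induction k)
  case 0
  show ?case using has_value_imp_vanishes[OF has_value_1] by (simp add: Q.num_prod_def)
next
  case (Suc k)
  define y where "y = qvar ^ (2 * k + 1)"
  define W where "W = Q.num_prod (qvar ^ d) k"
  have f: "(1 - qvar ^ d * y) * (1 - y / qvar ^ d) = (1 - y) ^ 2 - y * s"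
    unfolding s_def by (rule symmetric_factor) simp
  have h: "has_value z (1 - y) (1 - z ^ (2 * k + 1))" "has_value z y (z ^ (2 * k + 1))"
    unfolding y_def by (intro has_value_intros)+
  have hs: "has_value z s 0"
    using vanishes_mono[OF vanishes_s, of 1] by (simp add: vanishes_1_iff)
  have u: "vanishes z 0 ((1 - y) ^ 2 - y * s)"
    by (rule has_value_imp_vanishes, (rule has_value_intros h hs)+)
  have o: "Q.odds (Suc k) = Q.odds k * (1 - y)" by (simp add: Q.odds_Suc y_def)
  have n: "Q.num_prod (qvar ^ d) (Suc k) = W * ((1 - y) ^ 2 - y * s)"
    unfolding f[symmetric] by (simp add: Q.num_prod_def W_def y_def)
  have "W * ((1 - y) ^ 2 - y * s) - (Q.odds k * (1 - y)) ^ 2 = ((1 - y) ^ 2 - y * s) * (W - Q.odds k ^ 2) - (Q.odds k ^ 2 * y) * s"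
    by algebra
  moreover have "vanishes z 0 (Q.odds k ^ 2 * y)"
    using Suc.IH h(2) unfolding power2_eq_square
    by (intro vanishes_times) (auto dest: has_value_imp_vanishes)
  ultimately have "vanishes z 2 (W * ((1 - y) ^ 2 - y * s) - (Q.odds k * (1 - y)) ^ 2)"
    using Suc.IH u vanishes_s by (auto intro!: vanishes_diff vanishes_times simp: W_def)
  then show ?case unfolding o n using Suc.IH u has_value_imp_vanishes[OF h(1)]
    by (auto intro!: vanishes_times simp: W_def)
qed

lemma half_sum_cong:
  "vanishes z 3 ((\<Sum>k\<le>m. cq k) - (1 - qvar ^ d) / qvar ^ m * (\<Sum>k\<le>m. bq k ^ 3 * qvar ^ (2 * k)))"
proof -
  define a where "a k = (-1) ^ k * (1 - qvar ^ (4 * k + 1)) * bq k ^ 3 * qvar ^ (k ^ 2 + k)" for k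
  define F where "F = (\<Sum>k\<le>m. a k * Q.quot_prod (qvar ^ d) k)"
  define H where "H = (\<Sum>k\<le>m. bq k / Q.evens k ^ 2 * qvar ^ (2 * k) * Q.num_prod (qvar ^ d) k)"
  define H0 where "H0 = (\<Sum>k\<le>m. bq k ^ 3 * qvar ^ (2 * k))"
  have FH: "F * qvar ^ m = (1 - qvar ^ d) * H"
    using Q.watson_special[of m] unfolding F_def H_def a_def bq_def d[symmetric]
    by (simp add: mult_ac power2_eq_square power3_eq_cube)
  have ha: "has_value z (a k) ((-1) ^ k * (1 - z ^ (4 * k + 1)) * B k ^ 3 * z ^ (k ^ 2 + k))" if "k \<le> m" for k
    unfolding a_def using that d by (intro has_value_intros has_value_bq) auto
  have 1: "vanishes z 3 (F - (\<Sum>k\<le>m. a k * (bq k ^ 2 * (1 + s * correction k))))"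
    unfolding F_def sum_subtractf[symmetric] right_diff_distrib[symmetric]
    by (intro vanishes_sum vanishes_times quot_prod_cong) (auto intro: has_value_imp_vanishes ha)
  have "(\<Sum>k\<le>m. a k * (bq k ^ 2 * (1 + s * correction k))) = (\<Sum>k\<le>m. cq k) + s * (\<Sum>k\<le>m. cq k * correction k)"
    unfolding sum_distrib_left sum.distrib[symmetric]
    by (rule sum.cong) (simp_all add: a_def cq_def algebra_simps eval_nat_numeral)
  moreover have "vanishes z 3 (s * (\<Sum>k\<le>m. cq k * correction k))"
  proof -
    have "has_value z (\<Sum>k\<le>m. cq k * correction k) (\<Sum>k\<le>m. c k * E k)"
      unfolding cq_def c_def using d by (intro has_value_sum has_value_intros has_value_bq has_value_correction) auto
    then have "vanishes z 1 (\<Sum>k\<le>m. cq k * correction k)" by (simp add: c_E_sum vanishes_1_iff)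
    from vanishes_mult[OF vanishes_s this] show ?thesis by simp
  qed
  ultimately have 2: "vanishes z 3 (F - (\<Sum>k\<le>m. cq k))"
    using vanishes_add[OF 1] by fastforce
  have "vanishes z 2 (H - H0)"
    unfolding H_def H0_def sum_subtractf[symmetric]
  proof (rule vanishes_sum)
    fix k assume "k \<in> {..m}"
    then have k: "k \<le> m" by simp
    have "bq k / Q.evens k ^ 2 * qvar ^ (2 * k) * Q.num_prod (qvar ^ d) k - bq k ^ 3 * qvar ^ (2 * k)
      = (bq k * qvar ^ (2 * k) * (1 / Q.evens k ^ 2)) * (Q.num_prod (qvar ^ d) k - Q.odds k ^ 2)"
      by (simp add: bq_def right_diff_distrib diff_divide_distrib power3_eq_cube power2_eq_square mult_ac)
    moreover have "vanishes z 0 (bq k * qvar ^ (2 * k) * (1 / Q.evens k ^ 2))"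
    proof (rule has_value_imp_vanishes)
      \<comment> \<open>For k <= m all exponents 2(j+1) are below d, so \<open>Q.evens k\<close> is
        nonzero at z.\<close>
      have "1 - z ^ 2 * (z ^ 2) ^ j \<noteq> 0" if "j < k" for j
        using power_neq_1[of "2 * Suc j"] that k d unfolding power_mult power_Suc by simp
      then have "(\<Prod>j<k. 1 - z ^ 2 * (z ^ 2) ^ j) ^ 2 \<noteq> 0" by simp
      moreover have "has_value z (Q.evens k) (\<Prod>j<k. 1 - z ^ 2 * (z ^ 2) ^ j)"
        unfolding Q.evens_def qpoch_def by (intro has_value_prod has_value_intros)
      moreover have "has_value z (bq k) (B k)" using k d by (intro has_value_bq) simp
      ultimately show "has_value z (bq k * qvar ^ (2 * k) * (1 / Q.evens k ^ 2)) (B k * z ^ (2 * k) * (1 / (\<Prod>j<k. 1 - z ^ 2 * (z ^ 2) ^ j) ^ 2))"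
        by (intro has_value_intros)
    qed
    ultimately show "vanishes z 2 (bq k / Q.evens k ^ 2 * qvar ^ (2 * k) * Q.num_prod (qvar ^ d) k - bq k ^ 3 * qvar ^ (2 * k))"
      using num_prod_cong[of k] vanishes_times by metis
  qed
  then have "vanishes z (1 + 2) ((1 - qvar ^ d) * (H - H0))"
    by (intro vanishes_mult vanishes_1_minus)
  then have 3: "vanishes z 3 ((1 - qvar ^ d) * (H - H0) / qvar ^ m)"
    by (intro vanishes_divide[of _ _ _ _ "z ^ m"] has_value_intros) (simp_all add: numeral_3_eq_3)
  have "F = (1 - qvar ^ d) * H / qvar ^ m"
    using FH by (simp add: divide_simps)
  then have "(\<Sum>k\<le>m. cq k) - (1 - qvar ^ d) / qvar ^ m * H0 = (1 - qvar ^ d) * (H - H0) / qvar ^ m - (F - (\<Sum>k\<le>m. cq k))"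
    by (simp add: algebra_simps diff_divide_distrib add_divide_distrib)
  then show ?thesis using vanishes_diff[OF 3 2] unfolding H0_def by (simp only:)
qed

text \<open>For m < k < d the numerator of \<open>bq k\<close> contains 1 - q^d while its
  denominator is nonzero at z, so the fifth power in \<open>cq k\<close> has a zero of order at
  least 5.\<close>

lemma full_sum_cong: "vanishes z 3 ((\<Sum>k<d. cq k) - (\<Sum>k\<le>m. cq k))"
proof -
  have "(\<Sum>k<d. cq k) = (\<Sum>k\<le>m. cq k) + (\<Sum>k<m. cq (Suc m + k))"
    using sum_lessThan_add[of cq "Suc m" m] by (simp add: d mult_2 lessThan_Suc_atMost)
  moreover have "vanishes z 3 (\<Sum>k<m. cq (Suc m + k))"
  proof (rule vanishes_sum)
    fix i assume i: "i \<in> {..<m}"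
    define k where "k = Suc m + i"
    have "k < d" "m < k" using i d by (auto simp: k_def)
    then have "has_value z (bq k) 0" using has_value_bq[of k] B_eq_0[of k] by simp
    then have "vanishes z 5 (bq k ^ 5)" by (intro vanishes_power) (simp add: vanishes_1_iff)
    moreover have "has_value z ((-1) ^ k * (1 - qvar ^ (4 * k + 1)) * qvar ^ (k ^ 2 + k)) ((-1) ^ k * (1 - z ^ (4 * k + 1)) * z ^ (k ^ 2 + k))"
      by (intro has_value_intros)
    ultimately have "vanishes z 5 ((-1) ^ k * (1 - qvar ^ (4 * k + 1)) * qvar ^ (k ^ 2 + k) * bq k ^ 5)"
      using vanishes_times has_value_imp_vanishes by blast
    moreover have "(-1) ^ k * (1 - qvar ^ (4 * k + 1)) * qvar ^ (k ^ 2 + k) * bq k ^ 5 = cq k"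
      by (simp add: cq_def)
    ultimately show "vanishes z 3 (cq (Suc m + i))"
      using vanishes_mono[of z 5 "cq k" 3] by (simp add: k_def)
  qed
  ultimately show ?thesis by simp
qed

end

section \<open>Removing the factor 1 - q, and the two congruences\<close>

lemma qint_mult: "qint qvar k * (1 - qvar) = 1 - qvar ^ k"
proof (induction k)
  case (Suc k)
  have "qint qvar (Suc k) * (1 - qvar) = qint qvar k * (1 - qvar) + qvar ^ k * (1 - qvar)"
    by (simp add: qint_def distrib_right)
  then show ?case unfolding Suc by (simp add: right_diff_distrib)
qed (simp add: qint_def)

lemma vanishes_cancel_1_minus:
  assumes "vanishes z e (r * (1 - qvar))" "z \<noteq> 1" shows "vanishes z e r"
proof -
  have "vanishes z e (r * (1 - qvar) / (1 - qvar))"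
    using assms by (intro vanishes_divide[of _ _ _ _ "1 - z"] has_value_intros) simp_all
  moreover have "1 - qvar \<noteq> 0" using Q.one_minus_q_power[of 1] by simp
  ultimately show ?thesis by simp
qed

theorem theorem2p2:
  fixes n :: nat
  assumes "n > 0" and "odd n"
  shows
    "ratfun_cong
       (\<Sum>k=0..n-1. (-1) ^ k * qint qvar (4 * k + 1) *
          (qpoch qvar (qvar ^ 2) k ^ 5 / qpoch (qvar ^ 2) (qvar ^ 2) k ^ 5) * qvar ^ (k ^ 2 + k))
       (qint qvar n * qvar powi ((1 - int n) div 2) *
          (\<Sum>k=0..(n-1) div 2.
             qpoch qvar (qvar ^ 2) k ^ 3 / qpoch (qvar ^ 2) (qvar ^ 2) k ^ 3 * qvar ^ (2 * k)))
       (qint [:0, 1:] n * cyclotomic n ^ 2)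
     \<and>
     ratfun_cong
       (\<Sum>k=0..(n-1) div 2. (-1) ^ k * qint qvar (4 * k + 1) *
          (qpoch qvar (qvar ^ 2) k ^ 5 / qpoch (qvar ^ 2) (qvar ^ 2) k ^ 5) * qvar ^ (k ^ 2 + k))
       (qint qvar n * qvar powi ((1 - int n) div 2) *
          (\<Sum>k=0..(n-1) div 2.
             qpoch qvar (qvar ^ 2) k ^ 3 / qpoch (qvar ^ 2) (qvar ^ 2) k ^ 3 * qvar ^ (2 * k)))
       (qint [:0, 1:] n * cyclotomic n ^ 2)"
proof -
  obtain m where n: "n = 2 * m + 1" using \<open>odd n\<close> oddE by blast
  define b where "b k = qpoch qvar (qvar ^ 2) k ^ 5 / qpoch (qvar ^ 2) (qvar ^ 2) k ^ 5" for k
  define S where "S K = (\<Sum>k=0..K. (-1) ^ k * qint qvar (4 * k + 1) * b k * qvar ^ (k ^ 2 + k))" for K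
  define R where "R = qint qvar n * qvar powi ((1 - int n) div 2) *
          (\<Sum>k=0..(n-1) div 2.
             qpoch qvar (qvar ^ 2) k ^ 3 / qpoch (qvar ^ 2) (qvar ^ 2) k ^ 3 * qvar ^ (2 * k))"
  have S: "S K * (1 - qvar) = (\<Sum>k\<le>K. cq k)" for K
    unfolding S_def sum_distrib_right atMost_atLeast0
  proof (rule sum.cong[OF refl])
    fix k
    have "(-1) ^ k * qint qvar (4 * k + 1) * b k * qvar ^ (k ^ 2 + k) * (1 - qvar)
      = (-1) ^ k * (qint qvar (4 * k + 1) * (1 - qvar)) * b k * qvar ^ (k ^ 2 + k)" by (simp add: mult_ac)
    then show "(-1) ^ k * qint qvar (4 * k + 1) * b k * qvar ^ (k ^ 2 + k) * (1 - qvar) = cq k"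
      unfolding qint_mult by (simp add: cq_def b_def bq_def Q.odds_def Q.evens_def power_divide)
  qed
  have R: "R * (1 - qvar) = (1 - qvar ^ n) / qvar ^ m * (\<Sum>k\<le>m. bq k ^ 3 * qvar ^ (2 * k))"
  proof -
    \<comment> \<open>Both integer divisions are exact, n being odd.\<close>
    have e: "(1 - int n) div 2 = - int m" "(n - 1) div 2 = m" by (simp_all add: n)
    have "R * (1 - qvar) = (qint qvar n * (1 - qvar)) * qvar powi (- int m) *
        (\<Sum>k\<le>m. qpoch qvar (qvar ^ 2) k ^ 3 / qpoch (qvar ^ 2) (qvar ^ 2) k ^ 3 * qvar ^ (2 * k))"
      unfolding R_def e atMost_atLeast0 by (simp add: mult_ac)
    then show ?thesis
      unfolding qint_mult power_int_minus power_int_of_nat bq_def Q.odds_def Q.evens_def power_divide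
      by (simp only: divide_inverse)
  qed
  have "ratfun_cong (S (n - 1)) R (qint [:0, 1:] n * cyclotomic n ^ 2) \<and>
    ratfun_cong (S ((n - 1) div 2)) R (qint [:0, 1:] n * cyclotomic n ^ 2)"
  proof (cases "n = 1")
    \<comment> \<open>For n = 1 the modulus has its root at 1, where the factor 1 - q cannot be
      cancelled; here the two sides are equal.\<close>
    case True
    then have "S 0 = R" by (simp add: S_def R_def b_def qint_def)
    then show ?thesis using True by (simp add: ratfun_cong_def)
  next
    case False
    then have n1: "n > 1" using \<open>n > 0\<close> by simp
    have mid: "(n - 1) div 2 = m" by (simp add: n)
    have full: "(\<Sum>k\<le>n - 1. cq k) = (\<Sum>k<n. cq k)"
      using n1 by (intro sum.cong) auto
    have simple: "vanishes z 1 (S (n - 1) - R) \<and> vanishes z 1 (S m - R)" if z: "z ^ n = 1" "z \<noteq> 1" for z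
    proof -
      obtain d where d: "d dvd n" "z \<in> primitive_roots_of_unity d"
        using primitive_roots_of_unity_Union[OF \<open>n > 0\<close>] z(1) by blast
      then obtain r where r: "n = r * d" by (metis dvdE mult.commute)
      then obtain m' l where m': "d = 2 * m' + 1" and l: "r = 2 * l + 1"
        using \<open>odd n\<close> by (metis even_mult_iff oddE)
      have "d \<noteq> 1" using d(2) z(2) by (auto simp: primitive_roots_of_unity_def)
      then interpret odd_root z d m'
        using m' d(2) by unfold_locales auto
      have m: "m = l * d + m'" using n r l m' by (simp add: algebra_simps)
      \<comment> \<open>The zero comes from 1 - z^n. The sum beside it must be shown regular at z,
        since its denominators can vanish there when d < n.\<close>
      have "has_value z (R * (1 - qvar)) 0"
      proof -
        obtain c where "has_value z (\<Sum>k\<le>m. bq k ^ 3 * qvar ^ (2 * k)) c"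
        proof -
          have "vanishes z 0 (\<Sum>k\<le>m. bq k ^ 3 * qvar ^ (2 * k))"
          proof (rule vanishes_sum)
            fix k
            obtain \<beta> where "has_value z (bq k) \<beta>" using bq_regular_root by (auto simp: vanishes_0_iff)
            then have "has_value z (bq k ^ 3 * qvar ^ (2 * k)) (\<beta> ^ 3 * z ^ (2 * k))" by (intro has_value_intros)
            then show "vanishes z 0 (bq k ^ 3 * qvar ^ (2 * k))" by (rule has_value_imp_vanishes)
          qed
          then show ?thesis using that by (auto simp: vanishes_0_iff)
        qed
        then have "has_value z (R * (1 - qvar)) ((1 - z ^ n) / z ^ m * c)"
          unfolding R by (intro has_value_intros) simp_all
        then show ?thesis by (simp add: z)
      qed
      then have "vanishes z 1 ((S (n - 1) - R) * (1 - qvar))" "vanishes z 1 ((S m - R) * (1 - qvar))"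
        unfolding left_diff_distrib S full
        using cq_blocks[of r] cq_half_blocks[of l]
        by (auto intro!: has_value_diff[where c = 0 and d = 0, simplified] simp: vanishes_1_iff r m)
      then show ?thesis using vanishes_cancel_1_minus z(2) by blast
    qed
    have triple: "vanishes z 3 (S (n - 1) - R) \<and> vanishes z 3 (S m - R)" if z: "z \<in> primitive_roots_of_unity n" for z
    proof -
      interpret odd_root z n m
        using n n1 z by unfold_locales auto
      have "vanishes z 3 ((S m - R) * (1 - qvar))"
        unfolding left_diff_distrib S R by (rule half_sum_cong)
      moreover have "vanishes z 3 ((S (n - 1) - S m) * (1 - qvar))"
        unfolding left_diff_distrib S full by (rule full_sum_cong)
      moreover have "z \<noteq> 1" using power_neq_1[of 1] n1 by simp
      ultimately have "vanishes z 3 (S m - R)" "vanishes z 3 (S (n - 1) - S m)"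
        using vanishes_cancel_1_minus by blast+
      then show ?thesis using vanishes_add[of z 3 "S (n - 1) - S m" "S m - R"] by simp
    qed
    show ?thesis unfolding mid using simple triple by (intro conjI ratfun_congI n1) auto
  qed
  then show ?thesis unfolding S_def R_def b_def .
qed

end
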